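(* Let $1\le m\le n-1$ be integers, let $\mathbf W_0:\mathbf R^n\to\mathbf G(n,m)$ be Lipschitz and let $A\subseteq\mathbf R^n$ be Borel. The following are equivalent. (A) $\mathcal L^n(A)=0$; (B) for $\mathcal L^n$ almost every $x\in A$, $\mathcal H^m\big(A\cap(x+\mathbf W_0(x))\big)=0$; (C) for $\mathcal L^n$ almost every $x\in\mathbf R^n$, $\mathcal H^m\big(A\cap(x+\mathbf W_0(x))\big)=0$.
   Context: $\mathcal L^n$ is the Lebesgue outer measure on $\mathbf R^n$ and $\mathcal H^m$ the $m$-dimensional Hausdorff outer measure. $\mathbf G(n,m)$ is the Grassmannian of $m$-dimensional linear subspaces of $\mathbf R^n$, with the metric $d(W_1,W_2)=\|P_{W_1}-P_{W_2}\|$ (operator norm), where $P_W:\mathbf R^n\to\mathbf R^n$ is the orthogonal projection onto $W$. $\mathbf R^n$ carries the Euclidean metric. *)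

theory Defs
  imports "HOL-Analysis.Analysis"
begin

definition grassmannian :: "nat \<Rightarrow> 'a::euclidean_space set set" where
  "grassmannian m = {W. subspace W \<and> dim W = m}"

definition orth_proj :: "'a::euclidean_space set \<Rightarrow> 'a \<Rightarrow> 'a" where
  "orth_proj W x = (THE y. y \<in> W \<and> (\<forall>w\<in>W. (x - y) \<bullet> w = 0))"

lemma orth_proj_unique_exists:
  fixes W :: "'a::euclidean_space set"
  assumes "subspace W"
  shows "\<exists>!y. y \<in> W \<and> (\<forall>w\<in>W. (x - y) \<bullet> w = 0)"
proof -
  obtain y z where "y \<in> span W" and z: "\<And>w. w \<in> span W \<Longrightarrow> orthogonal z w" and x: "x = y + z"
    by (rule orthogonal_subspace_decomp_exists[of W x]) (rule that)
  then have y: "y \<in> W"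
    using span_eq_iff[THEN iffD2, OF assms] by simp
  have o: "(x - y) \<bullet> w = 0" if "w \<in> W" for w
    using z[OF span_base[OF that]] x by (simp add: orthogonal_def)
  have "v = y" if v: "v \<in> W" "\<forall>w\<in>W. (x - v) \<bullet> w = 0" for v
  proof -
    have "y - v \<in> W"
      using assms y v(1) by (rule subspace_diff)
    then have "(x - v) \<bullet> (y - v) - (x - y) \<bullet> (y - v) = 0"
      using v(2) o by simp
    then have "(y - v) \<bullet> (y - v) = 0"
      unfolding inner_diff_left by linarith
    then show ?thesis by simp
  qed
  with y o show ?thesis
    by metis
qed

definition grassmann_dist :: "'a::euclidean_space set \<Rightarrow> 'a set \<Rightarrow> real" where
  "grassmann_dist V W = onorm (\<lambda>x. orth_proj V x - orth_proj W x)"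

definition lipschitz_plane_field :: "nat \<Rightarrow> ('a::euclidean_space \<Rightarrow> 'a set) \<Rightarrow> bool" where
  "lipschitz_plane_field m W \<longleftrightarrow>
     (\<forall>x. W x \<in> grassmannian m) \<and>
     (\<exists>L\<ge>0. \<forall>x y. grassmann_dist (W x) (W y) \<le> L * dist x y)"

(* The usual normalisation: a set of diameter d counts as an m-ball of radius d / 2.
   The library's diameter is unspecified on unbounded sets, hence the explicit
   boundedness.  The empty set is treated separately because 0 ^ 0 = 1, which would
   matter for m = 0. *)
definition hausdorff_content :: "nat \<Rightarrow> real \<Rightarrow> 'a::metric_space set \<Rightarrow> ennreal" where
  "hausdorff_content m \<delta> E =
     (INF U \<in> {U :: nat \<Rightarrow> 'a set. E \<subseteq> (\<Union>i. U i) \<and> (\<forall>i. bounded (U i) \<and> diameter (U i) \<le> \<delta>)}.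
        \<Sum>i. if U i = {} then 0
            else ennreal (unit_ball_vol (real m) * (diameter (U i) / 2) ^ m))"

definition hausdorff_outer_measure :: "nat \<Rightarrow> 'a::metric_space set \<Rightarrow> ennreal" where
  "hausdorff_outer_measure m E = (SUP \<delta>\<in>{0<..}. hausdorff_content m \<delta> E)"

end

(* Write P_x v for the orthogonal projection of v onto W0(x).  A set in x + W0(x) is H^m-null iff its
   preimage under v |-> x + P_x v is Lebesgue null in R^n, so the sections are governed by the maps
   F_v(x) = x + P_x v, which are globally defined and Lipschitz in x.

   If A is not null, then for small v the map F_v is bi-Lipschitz and close to the identity, so A meets
   its F_v-preimage in positive measure; by Fubini (B) fails.

   Conversely let A be null.  By Rademacher's theorem x |-> P_x v is differentiable almost everywhere,
   and the derivative 1 + s D of F_{s v} is invertible for all but finitely many s.  Near points of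
   invertible derivative F_{s v} expands distances, so preimages of null sets are null there.  Hence
   for almost all s, and then by homogeneity of v |-> P_x v for a single s > 0, Fubini gives (C). *)

theory Submission
  imports Defs
begin

section \<open>Density points\<close>

text \<open>Replacing an m-plane section by its full-dimensional preimage gives all planes the
  single parameter space R^n. No bases of W0(x) have to be chosen measurably, and the map (x, v) |->
  x + P_x v is jointly continuous. Fubini is applied only to Borel conditions; neither derivatives
  nor Hausdorff measures of sections are ever shown measurable. For a null A, small v would cause no
  trouble, since F_v is then bi-Lipschitz. But sections are unbounded and A does not scale, while
  for large v the derivative 1 + D of F_v may be singular on a set of positive measure, where F_v
  can pull a null set back to a large one. The factor s is the remedy: with v frozen, the bad values
  of s at a point of differentiability are roots of the polynomial det(1 + s D), which is 1 at s =
  0. Only afterwards is v exchanged with the pair (s, x), so that one value of s serves almost all x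
  and v at once.\<close>

lemma lmeasurable_outer_open:
  fixes S :: "'a::euclidean_space set"
  assumes S: "S \<in> lmeasurable" and e: "e > 0"
  obtains U where "open U" "S \<subseteq> U" "U \<in> lmeasurable" "measure lebesgue U < measure lebesgue S + e"
proof -
  obtain U where U: "open U" "S \<subseteq> U" "U - S \<in> lmeasurable" "emeasure lebesgue (U - S) < ennreal e"
    using sets_lebesgue_outer_open[OF fmeasurableD[OF S] e] by blast
  have U': "U \<in> lmeasurable"
    using fmeasurable.Un[OF U(3) S] U(2) by (simp only: Un_Diff_cancel2 sup.absorb1)
  have "measure lebesgue (U - S) < e"
    using U(3,4) e by (simp add: emeasure_eq_measure2 ennreal_less_iff)
  then have "measure lebesgue U < measure lebesgue S + e"
    using measurable_measure_Diff[OF U' _ U(2)] S by simp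
  then show thesis
    using U(1,2) U' that by blast
qed

text \<open>The 5r selection principle, separated from what it measures. Disjointness of the chosen
  balls passes to sets \<open>E x r\<close>, possibly in another space, which are packed into
  \<open>U\<close>; this bounds every finite sum of weights. Density points, Lipschitz images and
  cylinders are all treated by a suitable choice of \<open>E\<close> and \<open>w\<close>.\<close>

lemma Vitali_weighted_covering:
  fixes K :: "('a::euclidean_space \<times> real) set" and E :: "'a \<Rightarrow> real \<Rightarrow> 'b::euclidean_space set"
  assumes K: "\<And>x r. (x, r) \<in> K \<Longrightarrow> 0 < r \<and> r \<le> 1"
    and E: "\<And>x r. (x, r) \<in> K \<Longrightarrow> E x r \<in> lmeasurable \<and> E x r \<subseteq> U \<and> w x r \<le> measure lebesgue (E x r)"
    and disj: "\<And>x r y s. \<lbrakk>(x, r) \<in> K; (y, s) \<in> K; disjnt (cball x r) (cball y s)\<rbrakk> \<Longrightarrow> disjnt (E x r) (E y s)"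
    and U: "U \<in> lmeasurable"
  obtains C where "countable C" "C \<subseteq> K" "fst ` K \<subseteq> (\<Union>(x, r)\<in>C. ball x (5 * r))"
    "\<And>I. \<lbrakk>finite I; I \<subseteq> C\<rbrakk> \<Longrightarrow> (\<Sum>(x, r)\<in>I. w x r) \<le> measure lebesgue U"
proof -
  obtain C where C: "countable C" "C \<subseteq> K"
    and pw: "pairwise (\<lambda>i j. disjnt (cball (fst i) (snd i)) (cball (fst j) (snd j))) C"
    and cov: "\<And>i. i \<in> K \<Longrightarrow> \<exists>j. j \<in> C \<and> \<not> disjnt (cball (fst i) (snd i)) (cball (fst j) (snd j)) \<and>
                        cball (fst i) (snd i) \<subseteq> ball (fst j) (5 * snd j)"
    by (rule Vitali_covering_lemma_cballs_balls[of K snd 1 fst]) (use K in auto)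
  show thesis
  proof
    show "fst ` K \<subseteq> (\<Union>(x, r)\<in>C. ball x (5 * r))"
    proof clarify
      fix x r assume xr: "(x, r) \<in> K"
      then obtain j where j: "j \<in> C" "cball x r \<subseteq> ball (fst j) (5 * snd j)"
        using cov by fastforce
      moreover have "x \<in> cball x r"
        using K[OF xr] by simp
      ultimately show "fst (x, r) \<in> (\<Union>(x, r)\<in>C. ball x (5 * r))"
        by (force simp: case_prod_beta)
    qed
    fix I assume I: "finite I" "I \<subseteq> C"
    have EI: "E x r \<in> lmeasurable" "E x r \<subseteq> U" "w x r \<le> measure lebesgue (E x r)" if "(x, r) \<in> I" for x r
      using E I C that by blast+
    have "(\<Sum>(x, r)\<in>I. w x r) \<le> (\<Sum>i\<in>I. measure lebesgue (E (fst i) (snd i)))"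
      using EI by (intro sum_mono) auto
    also have "\<dots> = measure lebesgue (\<Union>i\<in>I. E (fst i) (snd i))"
    proof (rule measure_UNION'[symmetric])
      show "pairwise (\<lambda>i j. disjnt (E (fst i) (snd i)) (E (fst j) (snd j))) I"
      proof (rule pairwiseI)
        fix i j assume ij: "i \<in> I" "j \<in> I" "i \<noteq> j"
        then have "disjnt (cball (fst i) (snd i)) (cball (fst j) (snd j))"
          using pw I by (auto simp: pairwise_def)
        then show "disjnt (E (fst i) (snd i)) (E (fst j) (snd j))"
          using disj[of "fst i" "snd i" "fst j" "snd j"] ij I C by auto
      qed
    qed (use I EI in auto)
    also have "\<dots> \<le> measure lebesgue U"
      by (rule measure_mono_fmeasurable) (use EI U I in \<open>auto intro!: sets.finite_UN, blast\<close>)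
    finally show "(\<Sum>(x, r)\<in>I. w x r) \<le> measure lebesgue U" .
  qed (use C in auto)
qed

text \<open>Companion to the Vitali selection: enlarging radii by \<open>t\<close> multiplies
  volumes by \<open>t ^ DIM('a)\<close>, wherever the balls are placed. The centres may be moved by
  \<open>f\<close> because a Lipschitz map sends a ball into a ball around the image of its
  centre.\<close>

lemma measure_countable_cballs_le:
  fixes C :: "('a::euclidean_space \<times> real) set"
  assumes "countable C" and C: "\<And>x r. (x, r) \<in> C \<Longrightarrow> 0 < r" and t: "t > 0"
    and bound: "\<And>I. \<lbrakk>finite I; I \<subseteq> C\<rbrakk> \<Longrightarrow> (\<Sum>(x, r)\<in>I. measure lebesgue (cball x r)) \<le> B"
  shows "(\<Union>(x, r)\<in>C. cball (f x) (t * r)) \<in> lmeasurable"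
    and "measure lebesgue (\<Union>(x, r)\<in>C. cball (f x) (t * r) :: 'a set) \<le> t ^ DIM('a) * B"
proof -
  have bd: "measure lebesgue (\<Union>(x, r)\<in>I. cball (f x) (t * r) :: 'a set) \<le> t ^ DIM('a) * B"
    if I: "I \<subseteq> C" "finite I" for I
  proof -
    have "measure lebesgue (\<Union>(x, r)\<in>I. cball (f x) (t * r)) \<le> (\<Sum>(x, r)\<in>I. measure lebesgue (cball (f x) (t * r)))"
      using measure_UNION_le[OF I(2), of "\<lambda>i. cball (f (fst i)) (t * snd i)" lebesgue]
      by (auto simp: case_prod_beta)
    also have "\<dots> = (\<Sum>(x, r)\<in>I. t ^ DIM('a) * measure lebesgue (cball x r))"
    proof (intro sum.cong refl, clarify)
      fix x r assume "(x, r) \<in> I"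
      then have "0 < r" using C I by blast
      then show "measure lebesgue (cball (f x) (t * r)) = t ^ DIM('a) * measure lebesgue (cball x r)"
        using t by (simp add: content_cball power_mult_distrib)
    qed
    also have "\<dots> \<le> t ^ DIM('a) * B"
      using bound[OF I(2,1)] t by (simp add: sum_distrib_left[symmetric] case_prod_beta)
    finally show ?thesis .
  qed
  have m: "(\<lambda>(x, r). cball (f x) (t * r)) i \<in> lmeasurable" for i
    by (auto simp: case_prod_beta)
  show "(\<Union>(x, r)\<in>C. cball (f x) (t * r)) \<in> lmeasurable"
    by (rule fmeasurable_UN_bound[OF assms(1) m bd])
  show "measure lebesgue (\<Union>(x, r)\<in>C. cball (f x) (t * r) :: 'a set) \<le> t ^ DIM('a) * B"
    by (rule measure_UN_bound[OF assms(1) m bd])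
qed

text \<open>Half of Lebesgue's density theorem. Bad balls inside an open \<open>U\<close> around
  \<open>S\<close> waste a fraction \<open>e\<close> of their volume on \<open>U - S\<close>, which
  is tiny. Hence disjoint bad balls have small total volume, and so do their fivefold enlargements,
  which cover the bad points.\<close>

lemma negligible_low_density_points:
  fixes S :: "'a::euclidean_space set"
  assumes S: "S \<in> lmeasurable" and e: "e > 0"
  shows "negligible {x \<in> S. \<forall>d>0. \<exists>r. 0 < r \<and> r < d \<and>
            e * measure lebesgue (cball x r) \<le> measure lebesgue (cball x r - S)}" (is "negligible ?T")
  unfolding negligible_outer_le
proof (intro allI impI)
  fix \<eta> :: real assume \<eta>: "\<eta> > 0"
  \<comment> \<open>Disjoint bad balls have total volume at most \<open>\<zeta> / e\<close>, and
    enlarging them five times turns this into \<open>\<eta>\<close>.\<close>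
  define \<zeta> where "\<zeta> = \<eta> * e / 5 ^ DIM('a)"
  have \<zeta>: "\<zeta> > 0" unfolding \<zeta>_def using \<eta> e by simp
  obtain U where U: "open U" "S \<subseteq> U" "U - S \<in> lmeasurable" "emeasure lebesgue (U - S) < ennreal \<zeta>"
    using sets_lebesgue_outer_open[of S \<zeta>] S \<zeta> by auto
  have mU: "measure lebesgue (U - S) < \<zeta>"
    using U(3,4) \<zeta> by (simp add: emeasure_eq_measure2 ennreal_less_iff)
  define K where "K = {(x, r). x \<in> ?T \<and> 0 < r \<and> r \<le> 1 \<and> cball x r \<subseteq> U \<and>
     e * measure lebesgue (cball x r) \<le> measure lebesgue (cball x r - S)}"
  obtain C where C: "countable C" "C \<subseteq> K" "fst ` K \<subseteq> (\<Union>(x, r)\<in>C. ball x (5 * r))"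
    and sum: "\<And>I. \<lbrakk>finite I; I \<subseteq> C\<rbrakk> \<Longrightarrow> (\<Sum>(x, r)\<in>I. e * measure lebesgue (cball x r)) \<le> measure lebesgue (U - S)"
  proof (rule Vitali_weighted_covering[of K "\<lambda>x r. cball x r - S" "U - S" "\<lambda>x r. e * measure lebesgue (cball x r)"])
    show "cball x r - S \<in> lmeasurable \<and> cball x r - S \<subseteq> U - S \<and>
        e * measure lebesgue (cball x r) \<le> measure lebesgue (cball x r - S)" if "(x, r) \<in> K" for x r
      using that S by (auto simp: K_def intro: fmeasurable_Diff)
  qed (use U(3) that in \<open>auto simp: K_def disjnt_def\<close>)
  have sum': "(\<Sum>(x, r)\<in>I. measure lebesgue (cball x r)) \<le> \<zeta> / e" if "finite I" "I \<subseteq> C" for I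
    using sum[OF that] mU e
    by (simp add: field_simps case_prod_beta sum_distrib_left[symmetric] sum_distrib_right[symmetric])
  have Cpos: "0 < r" if "(x, r) \<in> C" for x r
    using C that by (auto simp: K_def)
  have "x \<in> fst ` K" if x: "x \<in> ?T" for x
  proof -
    obtain d where d: "d > 0" "cball x d \<subseteq> U"
      using x U(2) open_contains_cball_eq[OF U(1)] by blast
    obtain r where r: "0 < r" "r < min d 1" "e * measure lebesgue (cball x r) \<le> measure lebesgue (cball x r - S)"
    proof -
      have "0 < min d 1" using d by simp
      with x show thesis using that by blast
    qed
    then have "cball x r \<subseteq> U"
      using d subset_cball[of r d x] by auto
    with r x show ?thesis
      by (force simp: K_def intro!: image_eqI[of _ _ "(x, r)"])
  qed
  then have "?T \<subseteq> fst ` K"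
    by (rule subsetI)
  also note C(3)
  also have "(\<Union>(x, r)\<in>C. ball x (5 * r)) \<subseteq> (\<Union>(x, r)\<in>C. cball x (5 * r))"
    by (auto simp: less_imp_le intro!: bexI)
  finally have T: "?T \<subseteq> (\<Union>(x, r)\<in>C. cball x (5 * r))" .
  have "measure lebesgue (\<Union>(x, r)\<in>C. cball x (5 * r)) \<le> 5 ^ DIM('a) * (\<zeta> / e)"
    by (rule measure_countable_cballs_le(2)[where f="\<lambda>x. x", OF C(1) Cpos _ sum']) simp_all
  also have "\<dots> = \<eta>"
    using e by (simp add: \<zeta>_def)
  finally have "measure lebesgue (\<Union>(x, r)\<in>C. cball x (5 * r)) \<le> \<eta>" .
  moreover have "(\<Union>(x, r)\<in>C. cball x (5 * r)) \<in> lmeasurable"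
    by (rule measure_countable_cballs_le(1)[where f="\<lambda>x. x", OF C(1) Cpos _ sum']) simp_all
  ultimately show "\<exists>T'. ?T \<subseteq> T' \<and> T' \<in> lmeasurable \<and> measure lebesgue T' \<le> \<eta>"
    using T by blast
qed

text \<open>The hole \<open>cball y (e * dist x y)\<close> lies in the ball of radius
  \<open>(1 + e) * dist x y\<close> around \<open>x\<close> and fills the fixed fraction
  \<open>(e / (1 + e)) ^ DIM('a)\<close> of it, so a porous point has low density. Intersecting with
  the balls \<open>ball 0 (real k)\<close> provides the finite measure that the density lemma asks
  for.\<close>

lemma negligible_porous_points:
  fixes S :: "'a::euclidean_space set"
  assumes S: "S \<in> sets lebesgue" and e: "e > 0"
  shows "negligible {x \<in> S. \<forall>d>0. \<exists>y. dist x y < d \<and> cball y (e * dist x y) \<inter> S = {}}" (is "negligible ?T")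
proof -
  define c where "c = (e / (1 + e)) ^ DIM('a)"
  have c: "c > 0" using e by (simp add: c_def)
  define T where "T k = {x \<in> S \<inter> ball 0 (real k). \<forall>d>0. \<exists>r. 0 < r \<and> r < d \<and>
            c * measure lebesgue (cball x r) \<le> measure lebesgue (cball x r - (S \<inter> ball 0 (real k)))}" for k
  have "negligible (T k)" for k
    unfolding T_def
    by (rule negligible_low_density_points[OF _ c]) (use S fmeasurable_Int_fmeasurable[of "ball 0 (real k)" lebesgue S] in \<open>simp add: Int_commute\<close>)
  then have "negligible (\<Union>k. T k)"
    by (intro negligible_countable_Union) auto
  moreover have "?T \<subseteq> (\<Union>k. T k)"
  proof clarify
    fix x assume x: "x \<in> S" and hole: "\<forall>d>0. \<exists>y. dist x y < d \<and> cball y (e * dist x y) \<inter> S = {}"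
    obtain k where k: "norm x < real k"
      using reals_Archimedean2 by blast
    have "\<exists>r. 0 < r \<and> r < d \<and> c * measure lebesgue (cball x r) \<le> measure lebesgue (cball x r - (S \<inter> ball 0 (real k)))"
      if d: "d > 0" for d
    proof -
      obtain y where y: "dist x y < d / (1 + e)" "cball y (e * dist x y) \<inter> S = {}"
        using hole d e by (metis add_pos_pos divide_pos_pos zero_less_one)
      \<comment> \<open>For \<open>y = x\<close> the hole would be \<open>{x}\<close>, which meets
        \<open>S\<close>.\<close>
      have xy: "dist x y > 0"
        using y(2) x by (auto simp: zero_less_dist_iff)
      define r where "r = (1 + e) * dist x y"
      have r: "0 < r" "r < d"
        using xy y(1) e by (simp_all add: r_def pos_less_divide_eq mult.commute)
      have sub: "cball y (e * dist x y) \<subseteq> cball x r"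
      proof
        fix z assume "z \<in> cball y (e * dist x y)"
        then show "z \<in> cball x r"
          using dist_triangle[of x z y] by (simp add: r_def algebra_simps)
      qed
      have "c * measure lebesgue (cball x r) = measure lebesgue (cball y (e * dist x y))"
        using e xy r by (simp add: content_cball c_def r_def power_mult_distrib power_divide)
      also have "\<dots> \<le> measure lebesgue (cball x r - (S \<inter> ball 0 (real k)))"
        using sub y(2) S fmeasurable_Diff[OF lmeasurable_cball, of "S \<inter> ball 0 (real k)" x r]
        by (intro measure_mono_fmeasurable) (auto simp: sets.Int)
      finally show ?thesis using r by blast
    qed
    then show "x \<in> (\<Union>k. T k)"
      using x k by (auto simp: T_def)
  qed
  ultimately show ?thesis
    by (rule negligible_subset)
qed

text \<open>The 5 comes from the Vitali enlargement: selected balls of radius r have total volume at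
  most that of \<open>U\<close>, and the image lies in balls of radius \<open>5 * L * r\<close>. The
  later use asks only for a constant depending on \<open>L\<close> and the dimension.\<close>

lemma measure_Lipschitz_image_le:
  fixes G :: "'a::euclidean_space \<Rightarrow> 'a"
  assumes T: "T \<in> lmeasurable" and L: "L > 0"
    and lip: "\<And>x y. \<lbrakk>x \<in> T; y \<in> T\<rbrakk> \<Longrightarrow> dist (G x) (G y) \<le> L * dist x y"
    and GT: "G ` T \<in> lmeasurable"
  shows "measure lebesgue (G ` T) \<le> (5 * L) ^ DIM('a) * measure lebesgue T"
proof (rule field_le_epsilon)
  fix \<eta> :: real assume \<eta>: "\<eta> > 0"
  define \<zeta> where "\<zeta> = \<eta> / (5 * L) ^ DIM('a)"
  have \<zeta>: "\<zeta> > 0" unfolding \<zeta>_def using \<eta> L by simp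
  obtain U where U: "open U" "T \<subseteq> U" and U': "U \<in> lmeasurable"
    and mU: "measure lebesgue U < measure lebesgue T + \<zeta>"
    using lmeasurable_outer_open[OF T \<zeta>] by blast
  define K where "K = {(x, r). x \<in> T \<and> 0 < r \<and> r \<le> 1 \<and> cball x r \<subseteq> U}"
  obtain C where C: "countable C" "C \<subseteq> K" "fst ` K \<subseteq> (\<Union>(x, r)\<in>C. ball x (5 * r))"
    and sum: "\<And>I. \<lbrakk>finite I; I \<subseteq> C\<rbrakk> \<Longrightarrow> (\<Sum>(x, r)\<in>I. measure lebesgue (cball x r)) \<le> measure lebesgue U"
    by (rule Vitali_weighted_covering[of K cball U "\<lambda>x r. measure lebesgue (cball x r)"])
      (use U' that in \<open>simp_all add: K_def\<close>)
  have Cpos: "0 < r" if "(x, r) \<in> C" for x r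
    using C that by (auto simp: K_def)
  have "x \<in> fst ` K" if x: "x \<in> T" for x
  proof -
    obtain d where d: "d > 0" "cball x d \<subseteq> U"
      using x U(2) open_contains_cball_eq[OF U(1)] by blast
    then have "cball x (min d 1) \<subseteq> U"
      using subset_cball[of "min d 1" d x] by auto
    with d x show ?thesis
      by (force simp: K_def intro!: image_eqI[of _ _ "(x, min d 1)"])
  qed
  then have *: "T \<subseteq> (\<Union>(x, r)\<in>C. ball x (5 * r))"
    using C(3) by fast
  have "G ` T \<subseteq> (\<Union>(x, r)\<in>C. cball (G x) ((5 * L) * r))"
  proof clarify
    fix y assume y: "y \<in> T"
    then obtain x r where xr: "(x, r) \<in> C" "y \<in> ball x (5 * r)"
      using * by auto
    then have "x \<in> T" using C by (auto simp: K_def)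
    then have "dist (G x) (G y) \<le> L * dist x y" using lip y by blast
    also have "\<dots> \<le> L * (5 * r)"
      using xr L by (intro mult_left_mono) auto
    finally show "G y \<in> (\<Union>(x, r)\<in>C. cball (G x) ((5 * L) * r))"
      using xr by (force simp: mult.commute mult.left_commute)
  qed
  then have "measure lebesgue (G ` T) \<le> measure lebesgue (\<Union>(x, r)\<in>C. cball (G x) ((5 * L) * r))"
    using GT L by (intro measure_mono_fmeasurable measure_countable_cballs_le(1)[OF C(1) Cpos _ sum]) auto
  also have "\<dots> \<le> (5 * L) ^ DIM('a) * measure lebesgue U"
    using L by (intro measure_countable_cballs_le(2)[OF C(1) Cpos _ sum]) auto
  also have "\<dots> \<le> (5 * L) ^ DIM('a) * (measure lebesgue T + \<zeta>)"
    using mU L by (intro mult_left_mono) auto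
  also have "\<dots> = (5 * L) ^ DIM('a) * measure lebesgue T + \<eta>"
    using L by (simp add: \<zeta>_def field_simps)
  finally show "measure lebesgue (G ` T) \<le> (5 * L) ^ DIM('a) * measure lebesgue T + \<eta>" .
qed

section \<open>Rademacher's theorem\<close>

text \<open>By Vitali's covering theorem, disjoint intervals of average slope at most
  \<open>p\<close> inside an open \<open>U\<close> cover almost all of \<open>E\<close>. Their
  images have total length at most \<open>p\<close> times the measure of \<open>U\<close>, and the
  uncovered null set has a null image because \<open>F\<close> is Lipschitz. Intervals are presented
  as closed balls around their midpoints to fit the covering theorem.\<close>

lemma measure_increasing_image_le:
  fixes F :: "real \<Rightarrow> real"
  assumes E: "E \<in> lmeasurable" and FE: "F ` E \<in> lmeasurable"
    and mono: "\<And>x y. x \<le> y \<Longrightarrow> F x \<le> F y"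
    and lip: "\<And>x y. \<bar>F x - F y\<bar> \<le> M * \<bar>x - y\<bar>"
    and p: "p > 0"
    and slope: "\<And>x d. \<lbrakk>x \<in> E; d > 0\<rbrakk> \<Longrightarrow> \<exists>a b. a < b \<and> x \<in> {a..b} \<and> b - a < d \<and> F b - F a \<le> p * (b - a)"
  shows "measure lebesgue (F ` E) \<le> p * measure lebesgue E"
proof (rule field_le_epsilon)
  fix \<eta> :: real assume \<eta>: "\<eta> > 0"
  define \<zeta> where "\<zeta> = \<eta> / p"
  have \<zeta>: "\<zeta> > 0" unfolding \<zeta>_def using \<eta> p by simp
  obtain U where U: "open U" "E \<subseteq> U" and U': "U \<in> lmeasurable"
    and mU: "measure lebesgue U < measure lebesgue E + \<zeta>"
    using lmeasurable_outer_open[OF E \<zeta>] by blast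
  define K where "K = {(a, b). a < b \<and> {a..b} \<subseteq> U \<and> F b - F a \<le> p * (b - a)}"
  have ball: "cball ((fst i + snd i) / 2) ((snd i - fst i) / 2) = {fst i..snd i}" for i :: "real \<times> real"
    by (simp add: cball_eq_atLeastAtMost field_simps)
  obtain C where C: "countable C" "C \<subseteq> K"
    and pw: "pairwise (\<lambda>i j. disjnt (cball ((fst i + snd i) / 2) ((snd i - fst i) / 2))
                        (cball ((fst j + snd j) / 2) ((snd j - fst j) / 2))) C"
    and neg: "negligible (E - (\<Union>i\<in>C. cball ((fst i + snd i) / 2) ((snd i - fst i) / 2)))"
  proof (rule Vitali_covering_theorem_cballs[of K "\<lambda>i. (snd i - fst i) / 2" E "\<lambda>i. (fst i + snd i) / 2"])
    show "0 < (snd i - fst i) / 2" if "i \<in> K" for i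
      using that by (auto simp: K_def)
    show "\<exists>i. i \<in> K \<and> x \<in> cball ((fst i + snd i) / 2) ((snd i - fst i) / 2) \<and> (snd i - fst i) / 2 < d"
      if x: "x \<in> E" and d: "d > 0" for x d
    proof -
      obtain e where e: "e > 0" "cball x e \<subseteq> U"
        using x U(2) open_contains_cball_eq[OF U(1)] by blast
      obtain a b where ab: "a < b" "x \<in> {a..b}" "b - a < min d e" "F b - F a \<le> p * (b - a)"
        using slope[OF x, of "min d e"] d e by auto
      have "{a..b} \<subseteq> cball x e"
        using ab(2,3) by (auto simp: dist_real_def)
      then have "(a, b) \<in> K"
        using ab e by (auto simp: K_def)
      moreover have "x \<in> cball ((fst (a, b) + snd (a, b)) / 2) ((snd (a, b) - fst (a, b)) / 2)"
        unfolding ball using ab by simp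
      moreover have "(snd (a, b) - fst (a, b)) / 2 < d"
        using ab d by simp
      ultimately show ?thesis by blast
    qed
  qed (use that in blast)
  have Cp: "fst i < snd i" "{fst i..snd i} \<subseteq> U" "F (snd i) - F (fst i) \<le> p * (snd i - fst i)" if "i \<in> C" for i
  proof -
    have "i \<in> K" using C(2) that by blast
    then show "fst i < snd i" "{fst i..snd i} \<subseteq> U" "F (snd i) - F (fst i) \<le> p * (snd i - fst i)"
      by (simp_all add: K_def case_prod_beta)
  qed
  have bd: "measure lebesgue (\<Union>i\<in>I. {F (fst i)..F (snd i)}) \<le> p * measure lebesgue U"
    if I: "I \<subseteq> C" "finite I" for I
  proof -
    have "measure lebesgue (\<Union>i\<in>I. {F (fst i)..F (snd i)}) \<le> (\<Sum>i\<in>I. measure lebesgue {F (fst i)..F (snd i)})"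
      using I by (intro measure_UNION_le) auto
    also have "\<dots> \<le> (\<Sum>i\<in>I. p * measure lebesgue {fst i..snd i})"
    proof (intro sum_mono)
      fix i assume "i \<in> I"
      then have "i \<in> C" using I by blast
      from Cp[OF this] mono show "measure lebesgue {F (fst i)..F (snd i)} \<le> p * measure lebesgue {fst i..snd i}"
        by simp
    qed
    also have "\<dots> = p * measure lebesgue (\<Union>i\<in>I. {fst i..snd i})"
    proof -
      have "pairwise (\<lambda>i j. disjnt {fst i..snd i} {fst j..snd j}) I"
        using pw I(1) unfolding ball by (rule pairwise_subset)
      then show ?thesis
        by (subst measure_UNION'[OF I(2)]) (auto simp: sum_distrib_left)
    qed
    also have "\<dots> \<le> p * measure lebesgue U"
    proof (intro mult_left_mono measure_mono_fmeasurable)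
      show "(\<Union>i\<in>I. {fst i..snd i}) \<subseteq> U"
        using Cp(2) I(1) by blast
    qed (use p U' I in \<open>auto intro!: sets.finite_UN\<close>)
    finally show ?thesis .
  qed
  have m: "{F (fst i)..F (snd i)} \<in> lmeasurable" for i :: "real \<times> real"
    by simp
  define V where "V = (\<Union>i\<in>C. {F (fst i)..F (snd i)})"
  have V: "V \<in> lmeasurable" "measure lebesgue V \<le> p * measure lebesgue U"
    unfolding V_def using fmeasurable_UN_bound[OF C(1) m bd] measure_UN_bound[OF C(1) m bd] by auto
  define N where "N = F ` (E - (\<Union>i\<in>C. {fst i..snd i}))"
  have N: "negligible N"
    unfolding N_def
  proof (rule negligible_locally_Lipschitz_image)
    show "negligible (E - (\<Union>i\<in>C. {fst i..snd i}))"
      using neg unfolding ball .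
    show "\<exists>T B. open T \<and> x \<in> T \<and> (\<forall>y\<in>(E - (\<Union>i\<in>C. {fst i..snd i})) \<inter> T. norm (F y - F x) \<le> B * norm (y - x))" for x
      using lip by (intro exI[of _ UNIV] exI[of _ M]) auto
  qed simp
  have "F ` E \<subseteq> V \<union> N"
  proof clarify
    fix x assume x: "x \<in> E" "F x \<notin> N"
    then have "x \<in> (\<Union>i\<in>C. {fst i..snd i})"
      unfolding N_def by blast
    then obtain i where "i \<in> C" "x \<in> {fst i..snd i}"
      by blast
    then show "F x \<in> V"
      using mono by (auto simp: V_def)
  qed
  then have "measure lebesgue (F ` E) \<le> measure lebesgue (V \<union> N)"
    using FE V N by (intro measure_mono_fmeasurable fmeasurable.Un) (auto simp: negligible_imp_measurable)
  also have "\<dots> = measure lebesgue V"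
    using V N by (intro measure_Un_null_set) (auto simp: negligible_iff_null_sets)
  also have "\<dots> \<le> p * (measure lebesgue E + \<zeta>)"
    using V(2) mU p by (meson less_imp_le mult_left_mono order_trans)
  also have "\<dots> = p * measure lebesgue E + \<eta>"
    using p by (simp add: \<zeta>_def field_simps)
  finally show "measure lebesgue (F ` E) \<le> p * measure lebesgue E + \<eta>" .
qed

text \<open>Multiplying slopes by \<open>(y - x)\<^sup>2\<close> treats both signs of
  \<open>y - x\<close> at once, excludes \<open>y = x\<close> by strictness, and gives conditions
  that are open in \<open>x\<close>. The lower bound 1 on slopes makes \<open>F\<close> invertible
  with a 1-Lipschitz inverse, so the measure estimate can be applied to \<open>F\<close> and to its
  inverse.\<close>

lemma negligible_slope_gap:
  fixes F :: "real \<Rightarrow> real"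
  assumes lower: "\<And>x y. x \<le> y \<Longrightarrow> y - x \<le> F y - F x"
    and upper: "\<And>x y. x \<le> y \<Longrightarrow> F y - F x \<le> M * (y - x)"
    and pq: "0 < p" "p < q"
  shows "negligible {x. (\<forall>d>0. \<exists>y. \<bar>y - x\<bar> < d \<and> (F y - F x) * (y - x) < p * (y - x)\<^sup>2) \<and>
                        (\<forall>d>0. \<exists>y. \<bar>y - x\<bar> < d \<and> (F y - F x) * (y - x) > q * (y - x)\<^sup>2)}"
    (is "negligible ?E")
proof -
  have mono: "F x \<le> F y" if "x \<le> y" for x y
    using lower[OF that] that by linarith
  have M: "M \<ge> 1"
    using lower[of 0 1] upper[of 0 1] by simp
  have lip: "\<bar>F x - F y\<bar> \<le> M * \<bar>x - y\<bar>" for x y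
    using upper[of x y] upper[of y x] mono[of x y] mono[of y x]
    by (cases "x \<le> y") (auto simp: abs_if algebra_simps)
  have cont: "continuous_on UNIV F"
  proof (rule lipschitz_on_continuous_on)
    show "M-lipschitz_on UNIV F"
      using lip M by (auto simp: lipschitz_on_def dist_real_def)
  qed
  have dist_ge: "\<bar>x - y\<bar> \<le> \<bar>F x - F y\<bar>" for x y
    using lower[of x y] lower[of y x] by (cases "x \<le> y") auto
  have inj: "inj F"
  proof (rule injI)
    show "x = y" if "F x = F y" for x y
      using dist_ge[of x y] that by simp
  qed
  have surj: "surj F"
    unfolding surj_def
  proof
    fix z
    \<comment> \<open>As slopes are at least 1, moving by \<open>\<bar>z - F 0\<bar>\<close> to
      either side of 0 is enough to pass the value \<open>z\<close>.\<close>
    define a where "a = - \<bar>z - F 0\<bar>"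
    have "F a \<le> z" "z \<le> F (- a)"
      using lower[of a 0] lower[of 0 "- a"] by (auto simp: a_def)
    moreover have "a \<le> - a" by (simp add: a_def)
    ultimately obtain x where "F x = z"
      using IVT'[of F a z "- a"] cont continuous_on_subset by blast
    then show "\<exists>x. z = F x" by blast
  qed
  \<comment> \<open>On the exceptional set \<open>F\<close> scales measure by at most \<open>p\<close> and its inverse by at most \<open>1 / q < 1 / p\<close>.\<close>
  define G where "G = inv F"
  have FG: "F (G z) = z" and GF: "G (F x) = x" for x z
    by (simp_all add: G_def surj surj_f_inv_f inj)
  have lipG: "\<bar>G x - G y\<bar> \<le> 1 * \<bar>x - y\<bar>" for x y
    using dist_ge[of "G x" "G y"] by (simp add: FG)
  have monoG: "G x \<le> G y" if "x \<le> y" for x y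
    using that mono[of "G y" "G x"] by (metis FG linorder_le_cases order_antisym)
  have contG: "continuous_on UNIV G"
  proof (rule lipschitz_on_continuous_on)
    show "1-lipschitz_on UNIV G"
      using lipG by (auto simp: lipschitz_on_def dist_real_def)
  qed
  define P where "P d = (\<Union>y. {x. \<bar>y - x\<bar> < d \<and> (F y - F x) * (y - x) < p * (y - x)\<^sup>2})" for d
  define Q where "Q d = (\<Union>y. {x. \<bar>y - x\<bar> < d \<and> (F y - F x) * (y - x) > q * (y - x)\<^sup>2})" for d
  have opn: "open (P d)" "open (Q d)" for d
    unfolding P_def Q_def
    by (intro open_UN ballI open_Collect_conj open_Collect_less continuous_intros continuous_on_subset[OF cont] subset_UNIV)+
  \<comment> \<open>Radii \<open>1 / Suc k\<close> suffice, so the exceptional set is a countable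
    intersection of open sets and hence Borel.\<close>
  have E_eq: "?E = (\<Inter>k::nat. P (1 / Suc k)) \<inter> (\<Inter>k::nat. Q (1 / Suc k))"
  proof (intro equalityI subsetI)
    fix x assume "x \<in> ?E"
    then show "x \<in> (\<Inter>k::nat. P (1 / Suc k)) \<inter> (\<Inter>k::nat. Q (1 / Suc k))"
      by (simp add: P_def Q_def)
  next
    fix x assume x: "x \<in> (\<Inter>k::nat. P (1 / Suc k)) \<inter> (\<Inter>k::nat. Q (1 / Suc k))"
    have "(\<exists>y. \<bar>y - x\<bar> < d \<and> (F y - F x) * (y - x) < p * (y - x)\<^sup>2) \<and>
          (\<exists>y. \<bar>y - x\<bar> < d \<and> (F y - F x) * (y - x) > q * (y - x)\<^sup>2)" if d: "d > 0" for d
    proof -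
      obtain k where k: "1 / Suc k < d"
        using nat_approx_posE[OF d] by auto
      have "x \<in> P (1 / Suc k)" "x \<in> Q (1 / Suc k)"
        using x by blast+
      then show ?thesis
        unfolding P_def Q_def using k by (smt (verit) UN_E mem_Collect_eq)
    qed
    then show "x \<in> ?E" by blast
  qed
  have Eb: "?E \<in> sets borel"
    unfolding E_eq using opn by (intro sets.Int sets.countable_INT) auto
  show ?thesis
    unfolding negligible_on_intervals[of ?E]
  proof (intro allI)
    fix u v :: real
    define E where "E = ?E \<inter> cbox u v"
    have Ebor: "E \<in> sets borel"
      unfolding E_def using Eb by auto
    then have E: "E \<in> lmeasurable"
      by (intro bounded_set_imp_lmeasurable) (auto simp: E_def bounded_Int)
    have "F ` E = G -` E"
      by (auto simp: GF FG image_iff) (metis FG)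
    then have "F ` E \<in> sets borel"
      using borel_measurable_continuous_onI[OF contG] Ebor by (simp add: measurable_sets_borel)
    moreover have "bounded (F ` E)"
    proof (rule bounded_subset)
      show "F ` E \<subseteq> {F u..F v}"
        using mono by (auto simp: E_def)
    qed simp
    ultimately have FE: "F ` E \<in> lmeasurable"
      by (intro bounded_set_imp_lmeasurable) auto
    have 1: "measure lebesgue (F ` E) \<le> p * measure lebesgue E"
    proof (rule measure_increasing_image_le[OF E FE mono lip])
      fix x d :: real assume x: "x \<in> E" and d: "d > 0"
      then obtain y where y: "\<bar>y - x\<bar> < d" "(F y - F x) * (y - x) < p * (y - x)\<^sup>2"
        unfolding E_def by blast
      then have "y \<noteq> x" by auto
      define a b where "a = min x y" and "b = max x y"
      have "(F b - F a) * (b - a) \<le> p * (b - a) * (b - a)"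
        using y(2) by (auto simp: a_def b_def min_def max_def power2_eq_square algebra_simps)
      moreover have "a < b" "b - a < d" "x \<in> {a..b}"
        using y \<open>y \<noteq> x\<close> by (auto simp: a_def b_def min_def max_def)
      ultimately show "\<exists>a b. a < b \<and> x \<in> {a..b} \<and> b - a < d \<and> F b - F a \<le> p * (b - a)"
        by (metis diff_gt_0_iff_gt mult_le_cancel_right_pos)
    qed (use pq in auto)
    have GFE: "G ` F ` E = E"
      by (simp add: image_comp GF)
    have 2: "measure lebesgue (G ` F ` E) \<le> 1 / q * measure lebesgue (F ` E)"
    proof (rule measure_increasing_image_le[OF FE _ monoG lipG])
      show "G ` F ` E \<in> lmeasurable"
        using E by (simp add: GFE)
      fix z d :: real assume "z \<in> F ` E" and d: "d > 0"
      then obtain x where x: "x \<in> E" "z = F x"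
        by blast
      \<comment> \<open>Lengths grow by at most the factor \<open>M\<close> under \<open>F\<close>,
        so the image interval will be shorter than \<open>d\<close>.\<close>
      then obtain y where y: "\<bar>y - x\<bar> < d / M" "(F y - F x) * (y - x) > q * (y - x)\<^sup>2"
        using d M unfolding E_def by (smt (verit) IntD1 divide_pos_pos mem_Collect_eq)
      then have "y \<noteq> x" by auto
      define a b where "a = min x y" and "b = max x y"
      have "q * (b - a) * (b - a) \<le> (F b - F a) * (b - a)"
        using y(2) by (auto simp: a_def b_def min_def max_def power2_eq_square algebra_simps)
      moreover have ab: "a < b" "b - a < d / M" "x \<in> {a..b}"
        using y \<open>y \<noteq> x\<close> by (auto simp: a_def b_def min_def max_def)
      ultimately have "q * (b - a) \<le> F b - F a"
        by (metis diff_gt_0_iff_gt mult_le_cancel_right_pos)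
      then have "G (F b) - G (F a) \<le> 1 / q * (F b - F a)"
        using pq by (simp add: GF field_simps)
      moreover have "F a < F b"
        using lower[of a b] ab by linarith
      moreover have "F b - F a < d"
      proof -
        have "F b - F a \<le> M * (b - a)"
          using upper ab by simp
        also have "\<dots> < d"
          using ab(2) M by (simp add: field_simps)
        finally show ?thesis .
      qed
      moreover have "z \<in> {F a..F b}"
        using mono ab x by auto
      ultimately show "\<exists>a b. a < b \<and> z \<in> {a..b} \<and> b - a < d \<and> G b - G a \<le> 1 / q * (b - a)"
        by blast
    qed (use pq in auto)
    have "q * measure lebesgue E \<le> p * measure lebesgue E"
      using 1 2 pq unfolding GFE by (simp add: field_simps)
    then have "measure lebesgue E = 0"
      using pq by (metis linorder_not_le measure_nonneg mult_le_cancel_right order_less_le)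
    then show "negligible (?E \<inter> cbox u v)"
      using E negligible_iff_measure E_def by blast
  qed
qed

text \<open>The limit is the lower limit, that is, the supremum \<open>s\<close> of all eventual
  lower bounds. Every \<open>p > s\<close> is undercut frequently, and \<open>gap\<close> then keeps
  the upper limit below any \<open>q > p\<close>. Since \<open>s\<close> is at least
  \<open>c\<close>, only \<open>p\<close> above \<open>c\<close> occur.\<close>

lemma bounded_slopes_convergent:
  fixes Q :: "real \<Rightarrow> real"
  assumes bounds: "\<And>h. h \<noteq> 0 \<Longrightarrow> c \<le> Q h \<and> Q h \<le> M"
    and gap: "\<And>p q. \<lbrakk>c < p; p < q; \<exists>\<^sub>F h in at 0. Q h < p\<rbrakk> \<Longrightarrow> \<forall>\<^sub>F h in at 0. Q h \<le> q"
  shows "\<exists>l. (Q \<longlongrightarrow> l) (at 0)"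
proof -
  define A where "A = {p. \<forall>\<^sub>F h in at 0. p \<le> Q h}"
  have ev: "\<forall>\<^sub>F h in at (0::real). h \<noteq> 0"
    by (rule eventually_neq_at_within)
  have cA: "c \<in> A"
    unfolding A_def using bounds by (auto intro: eventually_mono[OF ev])
  have bdd: "p \<le> M" if "p \<in> A" for p
  proof -
    have "\<forall>\<^sub>F h in at 0. p \<le> Q h \<and> h \<noteq> 0"
      using that ev by (auto simp: A_def eventually_conj_iff)
    then obtain h where "p \<le> Q h" "h \<noteq> 0"
      using eventually_happens'[of "at (0::real)"] by auto
    then show ?thesis using bounds[of h] by linarith
  qed
  then have bA: "bdd_above A" by (rule bdd_aboveI)
  define s where "s = Sup A"
  have "c \<le> s"
    unfolding s_def by (rule cSup_upper[OF cA bA])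
  have "(Q \<longlongrightarrow> s) (at 0)"
  proof (rule order_tendstoI)
    fix a assume "a < s"
    then obtain p where "p \<in> A" "a < p"
      unfolding s_def using less_cSupD[of A a] cA by blast
    then show "\<forall>\<^sub>F h in at 0. a < Q h"
      unfolding A_def by (auto elim: eventually_mono)
  next
    fix a assume a: "s < a"
    define p q where "p = (2 * s + a) / 3" and "q = (s + 2 * a) / 3"
    have pq: "s < p" "p < q" "q < a"
      using a by (auto simp: p_def q_def)
    then have "p \<notin> A"
      unfolding s_def using cSup_upper[OF _ bA] by fastforce
    then have "\<exists>\<^sub>F h in at 0. Q h < p"
      unfolding A_def frequently_def by (simp add: not_less)
    then have "\<forall>\<^sub>F h in at 0. Q h \<le> q"
      using gap[of p q] pq \<open>c \<le> s\<close> by simp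
    then show "\<forall>\<^sub>F h in at 0. Q h < a"
      using pq by (auto elim: eventually_mono)
  qed
  then show ?thesis by blast
qed

text \<open>Adding \<open>(L + 1) * x\<close> leaves differentiability unchanged and moves all
  slopes into the interval from 1 to \<open>2 * L + 1\<close>, as the slope gap lemma requires. At a
  point without derivative the slopes oscillate across a rational gap, and there are countably many
  such gaps.\<close>

theorem negligible_not_differentiable_Lipschitz_real:
  fixes f :: "real \<Rightarrow> real"
  assumes lip: "\<And>x y. \<bar>f x - f y\<bar> \<le> L * \<bar>x - y\<bar>"
  shows "negligible {x. \<nexists>D. (f has_real_derivative D) (at x)}"
proof -
  define F where "F x = f x + (L + 1) * x" for x
  have L: "L \<ge> 0" using lip[of 1 0] by simp
  have lower: "y - x \<le> F y - F x" and upper: "F y - F x \<le> (2 * L + 1) * (y - x)" if "x \<le> y" for x y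
    using lip[of x y] that by (auto simp: F_def algebra_simps abs_if split: if_splits)
  define E where "E p q = {x. (\<forall>d>0. \<exists>y. \<bar>y - x\<bar> < d \<and> (F y - F x) * (y - x) < p * (y - x)\<^sup>2) \<and>
                        (\<forall>d>0. \<exists>y. \<bar>y - x\<bar> < d \<and> (F y - F x) * (y - x) > q * (y - x)\<^sup>2)}" for p q
  define R where "R = {(p, q). p \<in> \<rat> \<and> q \<in> \<rat> \<and> 0 < p \<and> p < (q::real)}"
  have "countable R"
    by (rule countable_subset[of _ "\<rat> \<times> \<rat>"]) (auto simp: R_def countable_rat)
  then have "negligible (\<Union>(p, q)\<in>R. E p q)"
    by (intro negligible_countable_Union countable_image)
       (auto simp: E_def R_def intro!: negligible_slope_gap[OF lower upper])
  moreover have "{x. \<nexists>D. (f has_real_derivative D) (at x)} \<subseteq> (\<Union>(p, q)\<in>R. E p q)"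
  proof (rule subsetI, rule ccontr)
    fix x assume "x \<in> {x. \<nexists>D. (f has_real_derivative D) (at x)}" and x: "x \<notin> (\<Union>(p, q)\<in>R. E p q)"
    then have nd: "\<nexists>D. (f has_real_derivative D) (at x)" by simp
    define Q where "Q h = (F (x + h) - F x) / h" for h
    have freq: "\<exists>y. \<bar>y - x\<bar> < d \<and> P (y - x)" if "\<exists>\<^sub>F h in at 0. P h" "d > 0" for P d
    proof -
      have "\<forall>\<^sub>F h in at (0::real). \<bar>h\<bar> < d"
        using that(2) by (auto simp: eventually_at dist_real_def)
      from frequently_eventually_frequently[OF that(1) this]
      obtain h where "P h" "\<bar>h\<bar> < d"
        by (auto dest: frequently_ex)
      then show ?thesis by (intro exI[of _ "x + h"]) auto
    qed
    have conv: "\<exists>l. (Q \<longlongrightarrow> l) (at 0)"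
    proof (rule bounded_slopes_convergent)
      show "1 \<le> Q h \<and> Q h \<le> 2 * L + 1" if "h \<noteq> 0" for h
        using lower[of x "x + h"] upper[of x "x + h"] lower[of "x + h" x] upper[of "x + h" x] that
        by (cases "h > 0") (auto simp: Q_def field_simps)
      fix p q :: real assume pq: "1 < p" "p < q" and fr: "\<exists>\<^sub>F h in at 0. Q h < p"
      show "\<forall>\<^sub>F h in at 0. Q h \<le> q"
      proof (rule ccontr)
        assume "\<not> (\<forall>\<^sub>F h in at 0. Q h \<le> q)"
        then have fr2: "\<exists>\<^sub>F h in at 0. Q h > q"
          by (simp add: frequently_def not_less)
        \<comment> \<open>A rational pair inside the gap keeps both frequent inequalities strict and
          places \<open>x\<close> in one of the countably many sets \<open>E p' q'\<close>.\<close>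
        obtain p' where p': "p' \<in> \<rat>" "p < p'" "p' < q"
          using Rats_dense_in_real[OF pq(2)] by blast
        obtain q' where q': "q' \<in> \<rat>" "p' < q'" "q' < q"
          using Rats_dense_in_real[OF p'(3)] by blast
        have nz: "\<forall>\<^sub>F h in at (0::real). h \<noteq> 0"
          by (rule eventually_neq_at_within)
        have eq: "(F (x + h) - F x) * h = Q h * h\<^sup>2" if "h \<noteq> 0" for h
          using that by (simp add: Q_def power2_eq_square)
        have "\<exists>\<^sub>F h in at 0. (F (x + h) - F x) * h < p' * h\<^sup>2"
        proof (rule frequently_elim1[OF frequently_eventually_frequently[OF fr nz]])
          show "(F (x + h) - F x) * h < p' * h\<^sup>2" if "Q h < p \<and> h \<noteq> 0" for h
            using that p' by (subst eq) (auto intro!: mult_strict_right_mono)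
        qed
        moreover have "\<exists>\<^sub>F h in at 0. (F (x + h) - F x) * h > q' * h\<^sup>2"
        proof (rule frequently_elim1[OF frequently_eventually_frequently[OF fr2 nz]])
          show "(F (x + h) - F x) * h > q' * h\<^sup>2" if "q < Q h \<and> h \<noteq> 0" for h
            using that q' by (subst eq) (auto intro!: mult_strict_right_mono)
        qed
        ultimately have "x \<in> E p' q'"
          unfolding E_def using freq[of "\<lambda>h. (F (x + h) - F x) * h < p' * h\<^sup>2"]
            freq[of "\<lambda>h. (F (x + h) - F x) * h > q' * h\<^sup>2"] by simp
        moreover have "(p', q') \<in> R"
          using p' q' pq by (auto simp: R_def)
        ultimately show False using x by blast
      qed
    qed
    then obtain l where "(F has_real_derivative l) (at x)"
      unfolding Q_def DERIV_def by blast
    then have "((\<lambda>x. F x - (L + 1) * x) has_real_derivative (l - (L + 1))) (at x)"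
      by (auto intro!: derivative_eq_intros)
    moreover have "(\<lambda>x. F x - (L + 1) * x) = f"
      by (auto simp: F_def)
    ultimately show False using nd by auto
  qed
  ultimately show ?thesis
    by (rule negligible_subset)
qed

section \<open>Almost-everywhere statements and Fubini for null sets\<close>

lemma AE_lborel_iff_negligible:
  "(AE x in lborel. P x) \<longleftrightarrow> negligible {x::'a::euclidean_space. \<not> P x}"
proof
  assume "AE x in lborel. P x"
  then have "AE x in lebesgue. P x"
    by (rule AE_completion)
  then show "negligible {x. \<not> P x}"
    unfolding negligible_iff_null_sets using null_sets_completion_subset[of "{x. \<not> P x}" _ lborel]
    by (auto simp: eventually_ae_filter)
next
  assume "negligible {x. \<not> P x}"
  then have "AE x in lebesgue. P x"
    unfolding negligible_iff_null_sets by (auto simp: eventually_ae_filter)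
  then show "AE x in lborel. P x"
    by (simp only: AE_completion_iff)
qed

lemma AE_lborel_open_ex:
  fixes U :: "'a::euclidean_space set"
  assumes "AE x in lborel. P x" "open U" "U \<noteq> {}"
  obtains x where "x \<in> U" "P x"
  using assms open_not_negligible[of U] negligible_subset[of "{x. \<not> P x}" U]
  unfolding AE_lborel_iff_negligible by blast

lemma AE_lborel_commute:
  fixes P :: "'a::euclidean_space \<Rightarrow> 'b::euclidean_space \<Rightarrow> bool"
  assumes "{z. P (fst z) (snd z)} \<in> sets borel"
  shows "(AE x in lborel. AE y in lborel. P x y) \<longleftrightarrow> (AE y in lborel. AE x in lborel. P x y)"
  by (rule lborel_pair.AE_commute) (use assms in \<open>simp only: lborel_prod space_lborel space_borel sets_lborel UNIV_I simp_thms\<close>)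

lemma AE_lborel_translate:
  fixes c :: "'a::euclidean_space"
  assumes "AE x in lborel. P (x + c)"
  shows "AE x in lborel. P x"
proof -
  have "negligible ((+) c ` {x. \<not> P (x + c)})"
    using assms unfolding AE_lborel_iff_negligible by (rule negligible_translation)
  moreover have "{x. \<not> P x} \<subseteq> (+) c ` {x. \<not> P (x + c)}"
  proof
    fix x assume "x \<in> {x. \<not> P x}"
    then show "x \<in> (+) c ` {x. \<not> P (x + c)}"
      by (intro image_eqI[of _ _ "x - c"]) auto
  qed
  ultimately show ?thesis
    unfolding AE_lborel_iff_negligible by (rule negligible_subset)
qed

text \<open>Partial differentiability is encoded by countably many closed sets, so that Fubini applies without
  any measurability of derivatives, and so that porosity of each set can be ruled out almost everywhere.\<close>

definition slope_set :: "('a::euclidean_space \<Rightarrow> real) \<Rightarrow> 'a \<Rightarrow> real \<Rightarrow> real \<Rightarrow> real \<Rightarrow> 'a set" where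
  "slope_set f e \<epsilon> \<delta> c = {x. \<forall>h. \<bar>h\<bar> \<le> \<delta> \<longrightarrow> \<bar>f (x + h *\<^sub>R e) - f x - h * c\<bar> \<le> \<epsilon> * \<bar>h\<bar>}"

lemma closed_slope_set:
  assumes "continuous_on UNIV f"
  shows "closed (slope_set f e \<epsilon> \<delta> c)"
proof -
  have "slope_set f e \<epsilon> \<delta> c = (\<Inter>h\<in>{h. \<bar>h\<bar> \<le> \<delta>}. {x. \<bar>f (x + h *\<^sub>R e) - f x - h * c\<bar> \<le> \<epsilon> * \<bar>h\<bar>})"
    by (auto simp: slope_set_def)
  also have "closed \<dots>"
    by (intro closed_INT ballI closed_Collect_le continuous_intros continuous_on_compose2[OF assms])
       auto
  finally show ?thesis .
qed

text \<open>A Cauchy criterion with rational candidate slopes. For a Lipschitz \<open>f\<close>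
  these are exactly the points where the directional derivative along \<open>e\<close>
  exists.\<close>

definition slope_points :: "('a::euclidean_space \<Rightarrow> real) \<Rightarrow> 'a \<Rightarrow> 'a set" where
  "slope_points f e = (\<Inter>j::nat. \<Union>k::nat. \<Union>c\<in>\<rat>. slope_set f e (1 / Suc j) (1 / Suc k) c)"

lemma slope_points_borel:
  assumes "continuous_on UNIV f"
  shows "slope_points f e \<in> sets borel"
  unfolding slope_points_def
  by (intro sets.countable_INT sets.countable_nat_UN image_subsetI sets.countable_UN' countable_rat
      UNIV_not_empty borel_closed closed_slope_set assms)

lemma slope_pointsI:
  assumes "((\<lambda>s. f (x + s *\<^sub>R e)) has_real_derivative D) (at 0)"
  shows "x \<in> slope_points f e"
  unfolding slope_points_def
proof (intro INT_I)
  fix j :: nat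
  define \<epsilon> :: real where "\<epsilon> = 1 / Suc j"
  have \<epsilon>: "\<epsilon> > 0" by (simp add: \<epsilon>_def)
  obtain c where c: "c \<in> \<rat>" "D < c" "c < D + \<epsilon> / 2"
    using Rats_dense_in_real[of D "D + \<epsilon> / 2"] \<epsilon> by auto
  have "\<exists>d>0. \<forall>y. norm (y - 0) < d \<longrightarrow>
      norm (f (x + y *\<^sub>R e) - f (x + 0 *\<^sub>R e) - D * (y - 0)) \<le> (\<epsilon> / 2) * norm (y - 0)"
    using assms \<epsilon> unfolding has_field_derivative_def has_derivative_at_alt by (meson half_gt_zero)
  then obtain d where d: "d > 0"
    "\<And>h. \<bar>h\<bar> < d \<Longrightarrow> \<bar>f (x + h *\<^sub>R e) - f x - D * h\<bar> \<le> (\<epsilon> / 2) * \<bar>h\<bar>"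
    by auto
  obtain k where k: "1 / Suc k < d"
    using nat_approx_posE[OF d(1)] by auto
  have "\<bar>f (x + h *\<^sub>R e) - f x - h * c\<bar> \<le> \<epsilon> * \<bar>h\<bar>" if "\<bar>h\<bar> \<le> 1 / Suc k" for h
  proof -
    have "\<bar>h * (c - D)\<bar> \<le> \<bar>h\<bar> * (\<epsilon> / 2)"
      unfolding abs_mult using c by (intro mult_left_mono) auto
    moreover have "\<bar>f (x + h *\<^sub>R e) - f x - D * h\<bar> \<le> (\<epsilon> / 2) * \<bar>h\<bar>"
      using d(2)[of h] that k by linarith
    moreover have "f (x + h *\<^sub>R e) - f x - h * c = (f (x + h *\<^sub>R e) - f x - D * h) - h * (c - D)"
      by (simp add: algebra_simps)
    ultimately have "\<bar>f (x + h *\<^sub>R e) - f x - h * c\<bar> \<le> (\<epsilon> / 2) * \<bar>h\<bar> + \<bar>h\<bar> * (\<epsilon> / 2)"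
      by linarith
    then show ?thesis by (simp add: mult.commute)
  qed
  then have "x \<in> slope_set f e (1 / Suc j) (1 / Suc k) c"
    unfolding slope_set_def \<epsilon>_def by blast
  then show "x \<in> (\<Union>k::nat. \<Union>c\<in>\<rat>. slope_set f e (1 / Suc j) (1 / Suc k) c)"
    using c by blast
qed

text \<open>Tolerance and radius are returned in the form \<open>1 / Suc j\<close> and
  \<open>1 / Suc k\<close>, so that the slope set obtained can be recognised as a member of the
  countable family from which porous points are removed.\<close>

lemma slope_pointsE:
  assumes x: "x \<in> slope_points f e" and "\<epsilon> > 0"
  obtains \<epsilon>' \<delta> c j k where "0 < \<epsilon>'" "\<epsilon>' < \<epsilon>" "0 < \<delta>" "c \<in> \<rat>" "\<epsilon>' = 1 / Suc j" "\<delta> = 1 / Suc k"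
    "x \<in> slope_set f e \<epsilon>' \<delta> c"
proof -
  obtain j where j: "1 / Suc j < \<epsilon>"
    using nat_approx_posE[OF assms(2)] by auto
  obtain k c where "c \<in> \<rat>" "x \<in> slope_set f e (1 / Suc j) (1 / Suc k) c"
    using x unfolding slope_points_def by blast
  with j that[of "1 / Suc j" "1 / Suc k" c j k] show thesis by simp
qed

lemma slope_points_derivative:
  fixes f :: "'a::euclidean_space \<Rightarrow> real"
  assumes lip: "\<And>x y. \<bar>f x - f y\<bar> \<le> L * norm (x - y)" and x: "x \<in> slope_points f e"
  obtains D where "((\<lambda>s. f (x + s *\<^sub>R e)) has_real_derivative D) (at 0)"
proof -
  define Q where "Q h = (f (x + h *\<^sub>R e) - f x) / h" for h
  have "\<exists>l. (Q \<longlongrightarrow> l) (at 0)"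
  proof (rule bounded_slopes_convergent)
    show "- (L * norm e) \<le> Q h \<and> Q h \<le> L * norm e" if "h \<noteq> 0" for h
    proof -
      have "\<bar>Q h\<bar> \<le> L * norm e"
        using lip[of "x + h *\<^sub>R e" x] that by (simp add: Q_def abs_divide field_simps)
      then show ?thesis by linarith
    qed
    fix p q :: real assume pq: "p < q" and fr: "\<exists>\<^sub>F h in at 0. Q h < p"
    \<comment> \<open>Near 0 all slopes lie within \<open>\<epsilon>\<close> of \<open>c\<close>, a
      window narrower than \<open>q - p\<close>; one slope below \<open>p\<close> therefore forces
      all of them to be at most \<open>q\<close>.\<close>
    obtain \<epsilon> \<delta> c where e: "0 < \<epsilon>" "\<epsilon> < (q - p) / 2" "0 < \<delta>" "x \<in> slope_set f e \<epsilon> \<delta> c"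
      using slope_pointsE[OF x, of "(q - p) / 2"] pq by (metis diff_gt_0_iff_gt half_gt_zero)
    have "\<forall>\<^sub>F h in at 0. h \<noteq> 0 \<and> \<bar>h\<bar> \<le> \<delta>"
      unfolding eventually_at using e(3) by (intro exI[of _ \<delta>]) (auto simp: dist_real_def)
    then have ev: "\<forall>\<^sub>F h in at 0. \<bar>Q h - c\<bar> \<le> \<epsilon>"
    proof (rule eventually_mono)
      fix h assume h: "h \<noteq> 0 \<and> \<bar>h\<bar> \<le> \<delta>"
      then have "\<bar>f (x + h *\<^sub>R e) - f x - h * c\<bar> \<le> \<epsilon> * \<bar>h\<bar>"
        using e(4) by (simp add: slope_set_def)
      moreover have "f (x + h *\<^sub>R e) - f x - h * c = h * (Q h - c)"
        using h by (simp add: Q_def field_simps)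
      ultimately show "\<bar>Q h - c\<bar> \<le> \<epsilon>"
        using h by (simp add: abs_mult mult.commute)
    qed
    obtain h where "\<bar>Q h - c\<bar> \<le> \<epsilon>" "Q h < p"
      using frequently_eventually_frequently[OF fr ev] by (auto dest: frequently_ex)
    then have "c + \<epsilon> \<le> q"
      using e by (auto simp: field_simps)
    then show "\<forall>\<^sub>F h in at 0. Q h \<le> q"
      by (intro eventually_mono[OF ev]) linarith
  qed
  then obtain l where "(Q \<longlongrightarrow> l) (at 0)" ..
  then have "((\<lambda>s. f (x + s *\<^sub>R e)) has_real_derivative l) (at 0)"
    unfolding DERIV_def Q_def by simp
  then show thesis by (rule that)
qed

lemma continuous_on_Lipschitz:
  fixes f :: "'a::euclidean_space \<Rightarrow> 'b::euclidean_space"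
  assumes "\<And>x y. norm (f x - f y) \<le> L * norm (x - y)"
  shows "continuous_on UNIV f"
proof (rule lipschitz_on_continuous_on)
  obtain b :: 'a where "b \<in> Basis" by (meson nonempty_Basis ex_in_conv)
  then have "0 \<le> L"
    using assms[of b 0] norm_ge_zero[of "f b - f 0"] by (simp del: norm_ge_zero)
  then show "L-lipschitz_on UNIV f"
    using assms by (simp add: lipschitz_on_def dist_norm)
qed

text \<open>Every line in direction \<open>e\<close> is covered by the one-dimensional theorem.
  Instead of splitting the space into a hyperplane and a line, all base points \<open>x\<close> are
  kept: exchanging quantifiers yields one \<open>s\<close> for which
  \<open>x + s *\<^sub>R e\<close> is good for almost every \<open>x\<close>, and translation
  invariance removes the shift.\<close>

lemma AE_slope_points:
  fixes f :: "'a::euclidean_space \<Rightarrow> real"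
  assumes lip: "\<And>x y. \<bar>f x - f y\<bar> \<le> L * norm (x - y)"
  shows "AE x in lborel. x \<in> slope_points f e"
proof -
  have cont: "continuous_on UNIV f"
    using lip by (intro continuous_on_Lipschitz[of f L]) simp
  have "AE x in lborel. AE s in lborel. x + s *\<^sub>R e \<in> slope_points f e"
  proof (rule AE_I2)
    fix x
    define \<phi> where "\<phi> s = f (x + s *\<^sub>R e)" for s
    have "\<bar>\<phi> s - \<phi> t\<bar> \<le> (L * norm e) * \<bar>s - t\<bar>" for s t
      using lip[of "x + s *\<^sub>R e" "x + t *\<^sub>R e"]
      by (simp add: \<phi>_def scaleR_left_diff_distrib[symmetric] mult.commute mult.left_commute)
    then have "negligible {s. \<nexists>D. (\<phi> has_real_derivative D) (at s)}"
      by (rule negligible_not_differentiable_Lipschitz_real)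
    moreover have "{s. x + s *\<^sub>R e \<notin> slope_points f e} \<subseteq> {s. \<nexists>D. (\<phi> has_real_derivative D) (at s)}"
    proof safe
      fix s D assume "x + s *\<^sub>R e \<notin> slope_points f e" and D: "(\<phi> has_real_derivative D) (at s)"
      have "((\<lambda>t. f (x + s *\<^sub>R e + t *\<^sub>R e)) has_real_derivative D) (at 0)"
        using D DERIV_shift[of \<phi> D 0 s] by (simp add: \<phi>_def algebra_simps scaleR_left_distrib)
      then have "x + s *\<^sub>R e \<in> slope_points f e"
        by (rule slope_pointsI)
      then show False using \<open>x + s *\<^sub>R e \<notin> slope_points f e\<close> by simp
    qed
    ultimately show "AE s in lborel. x + s *\<^sub>R e \<in> slope_points f e"
      unfolding AE_lborel_iff_negligible by (rule negligible_subset)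
  qed
  moreover have "{z. fst z + snd z *\<^sub>R e \<in> slope_points f e} \<in> sets borel"
  proof -
    have "(\<lambda>z::'a \<times> real. fst z + snd z *\<^sub>R e) \<in> borel_measurable borel"
      by (intro borel_measurable_continuous_onI continuous_intros)
    from measurable_sets_borel[OF this slope_points_borel[OF cont, of e]] show ?thesis
      by (simp add: vimage_def)
  qed
  ultimately have "AE s in lborel. AE x in lborel. x + s *\<^sub>R e \<in> slope_points f e"
    by (subst (asm) AE_lborel_commute)
  then obtain s where "AE x in lborel. x + s *\<^sub>R e \<in> slope_points f e"
    using AE_lborel_open_ex[of _ UNIV] by blast
  then show ?thesis
    by (rule AE_lborel_translate)
qed

section \<open>Coordinate projections and total differentiability\<close>

definition coord_proj :: "'a::euclidean_space set \<Rightarrow> 'a \<Rightarrow> 'a" where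
  "coord_proj B v = (\<Sum>b\<in>B. (v \<bullet> b) *\<^sub>R b)"

lemma inner_coord_proj:
  assumes "B \<subseteq> Basis" "b \<in> Basis"
  shows "coord_proj B v \<bullet> b = (if b \<in> B then v \<bullet> b else 0)"
proof -
  have "coord_proj B v \<bullet> b = (\<Sum>c\<in>B. if c = b then v \<bullet> b else 0)"
    unfolding coord_proj_def inner_sum_left using assms
    by (intro sum.cong refl) (auto simp: inner_Basis subset_iff)
  then show ?thesis
    using finite_subset[OF assms(1) finite_Basis] by simp
qed

text \<open>The increment of \<open>f\<close> is telescoped along the coordinate directions. All
  steps but the first start away from \<open>x\<close>, where nothing is known about partial
  derivatives; discarding the porous points of countably many slope sets makes up for that.\<close>

theorem Rademacher_real:
  fixes f :: "'a::euclidean_space \<Rightarrow> real"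
  assumes lip: "\<And>x y. \<bar>f x - f y\<bar> \<le> L * norm (x - y)"
  shows "AE x in lborel. f differentiable (at x)"
proof -
  have cont: "continuous_on UNIV f"
    using lip by (intro continuous_on_Lipschitz[of f L]) simp
  define S where "S b j k c = slope_set f b (1 / Suc j) (1 / Suc k) c" for b and j k :: nat and c
  define bad where "bad b j k c = {x \<in> S b j k c. \<forall>d>0. \<exists>y. dist x y < d \<and> cball y (1 / Suc j * dist x y) \<inter> S b j k c = {}}"
    for b and j k :: nat and c
  have bad: "AE x in lborel. x \<notin> bad b j k c" for b j k c
    unfolding AE_lborel_iff_negligible bad_def S_def not_not
    using negligible_porous_points[of "slope_set f b (1 / Suc j) (1 / Suc k) c" "1 / Suc j"]
      closed_slope_set[OF cont, of b "1 / Suc j" "1 / Suc k" c]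
    by (auto simp: borel_closed)
  have "AE x in lborel. \<forall>b\<in>Basis. \<forall>j k. \<forall>c\<in>\<rat>. x \<notin> bad b j k c"
    using bad by (simp add: AE_ball_countable countable_rat AE_all_countable countable_finite)
  moreover have "AE x in lborel. \<forall>b\<in>Basis. x \<in> slope_points f b"
    using AE_slope_points[OF lip] by (simp add: AE_ball_countable countable_finite)
  ultimately show ?thesis
  proof eventually_elim
    case (elim x)
    have "\<forall>b\<in>Basis. \<exists>D. ((\<lambda>s. f (x + s *\<^sub>R b)) has_real_derivative D) (at 0)"
      using elim(2) slope_points_derivative[OF lip] by metis
    then obtain D where D: "\<And>b. b \<in> Basis \<Longrightarrow> ((\<lambda>s. f (x + s *\<^sub>R b)) has_real_derivative D b) (at 0)"
      by metis
    have L: "L \<ge> 0"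
    proof -
      obtain b :: 'a where "b \<in> Basis" by (meson nonempty_Basis ex_in_conv)
      then show ?thesis using lip[of b 0] by simp
    qed
    \<comment> \<open>Near \<open>x\<close> every point is within \<open>\<epsilon>' * dist x u\<close> of the slope set, where the partial difference
      quotient is uniformly controlled; this replaces continuity of the partial derivative.\<close>
    have step: "\<exists>d>0. \<forall>u t. dist x u < d \<longrightarrow> \<bar>t\<bar> < d \<longrightarrow>
        \<bar>f (u + t *\<^sub>R b) - f u - t * D b\<bar> \<le> 2 * (1 + L) * \<epsilon> * (\<bar>t\<bar> + dist x u)"
      if b: "b \<in> Basis" and \<epsilon>: "\<epsilon> > 0" for b \<epsilon>
    proof -
      obtain \<epsilon>' \<delta> c j k where s: "0 < \<epsilon>'" "\<epsilon>' < \<epsilon>" "0 < \<delta>" "c \<in> \<rat>" "\<epsilon>' = 1 / Suc j" "\<delta> = 1 / Suc k"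
        "x \<in> slope_set f b \<epsilon>' \<delta> c"
        using slope_pointsE[OF bspec[OF elim(2) b] \<epsilon>] .
      have xS: "x \<in> S b j k c"
        using s by (simp add: S_def)
      have "x \<notin> bad b j k c"
        using elim(1) b s(4) by blast
      then obtain d where d: "d > 0" "\<And>y. dist x y < d \<Longrightarrow> cball y (\<epsilon>' * dist x y) \<inter> S b j k c \<noteq> {}"
        using xS unfolding bad_def s(5) by blast
      \<comment> \<open>Membership of \<open>x\<close> in the slope set bounds the distance of
        \<open>c\<close> to all small difference quotients, hence to their limit.\<close>
      have cD: "\<bar>c - D b\<bar> \<le> \<epsilon>'"
      proof (rule tendsto_upperbound)
        show "((\<lambda>h. \<bar>c - (f (x + h *\<^sub>R b) - f x) / h\<bar>) \<longlongrightarrow> \<bar>c - D b\<bar>) (at 0)"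
          using D[OF b] unfolding DERIV_def by (intro tendsto_intros) simp
        have "\<forall>\<^sub>F h in at 0. h \<noteq> 0 \<and> \<bar>h\<bar> \<le> \<delta>"
          unfolding eventually_at using s(3) by (intro exI[of _ \<delta>]) (auto simp: dist_real_def)
        then show "\<forall>\<^sub>F h in at 0. \<bar>c - (f (x + h *\<^sub>R b) - f x) / h\<bar> \<le> \<epsilon>'"
        proof (rule eventually_mono)
          fix h assume h: "h \<noteq> 0 \<and> \<bar>h\<bar> \<le> \<delta>"
          then have "\<bar>f (x + h *\<^sub>R b) - f x - h * c\<bar> \<le> \<epsilon>' * \<bar>h\<bar>"
            using s(7) by (simp add: slope_set_def)
          moreover have "f (x + h *\<^sub>R b) - f x - h * c = - (h * (c - (f (x + h *\<^sub>R b) - f x) / h))"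
            using h by (simp add: field_simps)
          ultimately show "\<bar>c - (f (x + h *\<^sub>R b) - f x) / h\<bar> \<le> \<epsilon>'"
            using h by (simp add: abs_mult mult.commute)
        qed
      qed simp
      have "\<bar>f (u + t *\<^sub>R b) - f u - t * D b\<bar> \<le> 2 * (1 + L) * \<epsilon> * (\<bar>t\<bar> + dist x u)"
        if u: "dist x u < d" and t: "\<bar>t\<bar> \<le> \<delta>" for u t
      proof -
        \<comment> \<open>The slope estimate holds at \<open>y\<close>; moving both endpoints from
          \<open>u\<close> to \<open>y\<close> costs \<open>L * (\<epsilon>' * dist x u)\<close>
          each.\<close>
        obtain y where y: "dist u y \<le> \<epsilon>' * dist x u" "y \<in> S b j k c"
          using d(2)[OF u] by auto
        then have 1: "\<bar>f (y + t *\<^sub>R b) - f y - t * c\<bar> \<le> \<epsilon>' * \<bar>t\<bar>"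
          using t s(5,6) by (simp add: S_def slope_set_def)
        have "L * norm (u - y) \<le> L * (\<epsilon>' * dist x u)"
          using y L by (intro mult_left_mono) (auto simp: dist_norm)
        then have 2: "\<bar>f (u + t *\<^sub>R b) - f (y + t *\<^sub>R b)\<bar> \<le> L * (\<epsilon>' * dist x u)" "\<bar>f u - f y\<bar> \<le> L * (\<epsilon>' * dist x u)"
          using lip[of "u + t *\<^sub>R b" "y + t *\<^sub>R b"] lip[of u y] by auto
        have 3: "\<bar>t * c - t * D b\<bar> \<le> \<epsilon>' * \<bar>t\<bar>"
          using mult_left_mono[OF cD, of "\<bar>t\<bar>"] by (simp add: abs_mult[symmetric] algebra_simps)
        have "\<bar>f (u + t *\<^sub>R b) - f u - t * D b\<bar> \<le> 2 * \<epsilon>' * \<bar>t\<bar> + 2 * (L * (\<epsilon>' * dist x u))"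
          using 1 2 3 by linarith
        also have "\<dots> \<le> 2 * (1 + L) * \<epsilon>' * (\<bar>t\<bar> + dist x u)"
          using L s(1) by (simp add: algebra_simps)
        also have "\<dots> \<le> 2 * (1 + L) * \<epsilon> * (\<bar>t\<bar> + dist x u)"
          using L s(2) by (intro mult_right_mono mult_left_mono) auto
        finally show ?thesis .
      qed
      then show ?thesis
        using d(1) s(3) by (intro exI[of _ "min d \<delta>"]) auto
    qed
    have norm_part: "norm (coord_proj B h) \<le> norm h" if "B \<subseteq> Basis" for B and h :: 'a
      by (rule norm_le_componentwise) (simp add: inner_coord_proj[OF that])
    \<comment> \<open>Induction over coordinates: a step has length
      \<open>\<bar>h \<bullet> b\<bar>\<close> and starts at distance
      \<open>norm (coord_proj B h)\<close> from \<open>x\<close>, both at most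
      \<open>norm h\<close>. Hence 2 becomes 4 in the error of each step.\<close>
    have total: "\<exists>d>0. \<forall>h. norm h < d \<longrightarrow>
        \<bar>f (x + coord_proj B h) - f x - (\<Sum>b\<in>B. (h \<bullet> b) * D b)\<bar> \<le> real (card B) * (4 * (1 + L) * \<epsilon>) * norm h"
      if B: "B \<subseteq> Basis" and \<epsilon>: "\<epsilon> > 0" for B \<epsilon>
      using finite_subset[OF B finite_Basis] B
    proof (induction B rule: finite_induct)
      case empty
      show ?case by (intro exI[of _ 1]) (simp add: coord_proj_def)
    next
      case (insert b B)
      then obtain d1 where d1: "d1 > 0" "\<And>h. norm h < d1 \<Longrightarrow>
        \<bar>f (x + coord_proj B h) - f x - (\<Sum>b\<in>B. (h \<bullet> b) * D b)\<bar> \<le> real (card B) * (4 * (1 + L) * \<epsilon>) * norm h"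
        by auto
      obtain d2 where d2: "d2 > 0" "\<And>u t. \<lbrakk>dist x u < d2; \<bar>t\<bar> < d2\<rbrakk> \<Longrightarrow>
        \<bar>f (u + t *\<^sub>R b) - f u - t * D b\<bar> \<le> 2 * (1 + L) * \<epsilon> * (\<bar>t\<bar> + dist x u)"
        using step[of b \<epsilon>] insert.prems \<epsilon> by auto
      have "\<bar>f (x + coord_proj (insert b B) h) - f x - (\<Sum>b\<in>insert b B. (h \<bullet> b) * D b)\<bar>
          \<le> real (card (insert b B)) * (4 * (1 + L) * \<epsilon>) * norm h" if h: "norm h < min d1 d2" for h
      proof -
        have np: "norm (coord_proj B h) \<le> norm h" "\<bar>h \<bullet> b\<bar> \<le> norm h"
          using norm_part[of B h] insert.prems Basis_le_norm by auto
        have "\<bar>f (x + coord_proj B h + (h \<bullet> b) *\<^sub>R b) - f (x + coord_proj B h) - (h \<bullet> b) * D b\<bar>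
            \<le> 2 * (1 + L) * \<epsilon> * (\<bar>h \<bullet> b\<bar> + dist x (x + coord_proj B h))"
          using np h by (intro d2(2)) (auto simp: dist_norm)
        also have "\<dots> \<le> 2 * (1 + L) * \<epsilon> * (2 * norm h)"
          using np L \<epsilon> by (intro mult_left_mono) (auto simp: dist_norm)
        finally have 2: "\<bar>f (x + coord_proj B h + (h \<bullet> b) *\<^sub>R b) - f (x + coord_proj B h) - (h \<bullet> b) * D b\<bar>
            \<le> 4 * (1 + L) * \<epsilon> * norm h" by (simp add: algebra_simps)
        have e1: "x + coord_proj (insert b B) h = x + coord_proj B h + (h \<bullet> b) *\<^sub>R b"
          using insert.hyps by (simp add: coord_proj_def)
        have e2: "(\<Sum>b\<in>insert b B. (h \<bullet> b) * D b) = (h \<bullet> b) * D b + (\<Sum>b\<in>B. (h \<bullet> b) * D b)"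
          using insert.hyps by simp
        have e3: "real (card (insert b B)) * (4 * (1 + L) * \<epsilon>) * norm h
            = 4 * (1 + L) * \<epsilon> * norm h + real (card B) * (4 * (1 + L) * \<epsilon>) * norm h"
          using insert.hyps by (simp add: algebra_simps)
        show ?thesis
        proof -
          have "\<bar>f (x + coord_proj B h) - f x - (\<Sum>b\<in>B. (h \<bullet> b) * D b)\<bar> \<le> real (card B) * (4 * (1 + L) * \<epsilon>) * norm h"
            using d1(2) h by simp
          with 2 show ?thesis
            unfolding e1 e2 e3 by linarith
        qed
      qed
      then show ?case
        using d1(1) d2(1) by (intro exI[of _ "min d1 d2"]) auto
    qed
    have "(f has_derivative (\<lambda>h. \<Sum>b\<in>Basis. (h \<bullet> b) * D b)) (at x)"
      unfolding has_derivative_at_alt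
    proof (intro conjI allI impI)
      show "bounded_linear (\<lambda>h. \<Sum>b\<in>Basis. (h \<bullet> b) * D b)"
        by (intro bounded_linear_intros)
      fix e :: real assume e: "0 < e"
      define \<epsilon> where "\<epsilon> = e / (real DIM('a) * (4 * (1 + L)))"
      have "\<epsilon> > 0"
        using e L by (simp add: \<epsilon>_def)
      then obtain d where d: "d > 0" "\<And>h. norm h < d \<Longrightarrow>
        \<bar>f (x + coord_proj Basis h) - f x - (\<Sum>b\<in>Basis. (h \<bullet> b) * D b)\<bar> \<le> real DIM('a) * (4 * (1 + L) * \<epsilon>) * norm h"
        using total[of Basis \<epsilon>] by auto
      have "real DIM('a) * (4 * (1 + L) * \<epsilon>) = e"
        using L by (simp add: \<epsilon>_def)
      then show "\<exists>d>0. \<forall>y. norm (y - x) < d \<longrightarrow>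
          norm (f y - f x - (\<Sum>b\<in>Basis. ((y - x) \<bullet> b) * D b)) \<le> e * norm (y - x)"
        using d(2)[of "_ - x"] by (intro exI[of _ d] conjI d(1)) (auto simp: coord_proj_def euclidean_representation)
    qed
    then show ?case
      unfolding differentiable_def by blast
  qed
qed

corollary Rademacher:
  fixes f :: "'a::euclidean_space \<Rightarrow> 'b::euclidean_space"
  assumes lip: "\<And>x y. norm (f x - f y) \<le> L * norm (x - y)"
  shows "AE x in lborel. f differentiable (at x)"
proof -
  have "AE x in lborel. (\<lambda>x. f x \<bullet> b) differentiable (at x)" if "b \<in> Basis" for b
  proof (rule Rademacher_real)
    show "\<bar>f x \<bullet> b - f y \<bullet> b\<bar> \<le> L * norm (x - y)" for x y
      using Basis_le_norm[OF that, of "f x - f y"] lip[of x y] by (simp add: inner_diff_left)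
  qed
  then have "AE x in lborel. \<forall>b\<in>Basis. (\<lambda>x. f x \<bullet> b) differentiable (at x)"
    by (simp add: AE_ball_countable countable_finite)
  then show ?thesis
    by eventually_elim (simp add: differentiable_componentwise_within[of f])
qed

section \<open>Preimages of null sets\<close>

lemma finite_singular_perturbations:
  fixes D :: "real^'n \<Rightarrow> real^'n"
  assumes "linear D"
  shows "finite {s. \<not> inj (\<lambda>h. h + s *\<^sub>R D h)}"
proof -
  \<comment> \<open>\<open>det (1 + s D)\<close> is a polynomial in \<open>s\<close> with value 1 at 0.\<close>
  let ?M = "matrix D"
  define q where "q = (\<Sum>p\<in>{p. p permutes (UNIV :: 'n set)}. smult (of_int (sign p))
      (\<Prod>i\<in>UNIV. [:(mat 1 :: real^'n^'n) $ i $ p i, ?M $ i $ p i:]))"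
  have q: "poly q s = det (mat 1 + s *\<^sub>R ?M)" for s
    by (simp add: q_def det_def poly_sum poly_prod)
  have lin: "linear (\<lambda>h. h + s *\<^sub>R D h)" for s
    by (intro linear_compose_add linear_ident linear_compose_scale_right assms)
  have "matrix (\<lambda>h. h + s *\<^sub>R D h) = mat 1 + s *\<^sub>R ?M" for s
    by (simp add: matrix_def mat_def vec_eq_iff axis_def)
  then have "{s. \<not> inj (\<lambda>h. h + s *\<^sub>R D h)} = {s. poly q s = 0}"
    using det_nz_iff_inj[OF lin] by (auto simp: q)
  moreover have "poly q 0 \<noteq> 0"
    by (simp add: q)
  then have "q \<noteq> 0" by auto
  ultimately show ?thesis
    using poly_roots_finite by simp
qed

text \<open>One number serves as radius and as expansion factor. The sets then grow as
  \<open>r\<close> decreases, so the values \<open>1 / Suc k\<close> exhaust them, and the condition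
  is closed jointly in \<open>x\<close> and a parameter on which \<open>F\<close> depends
  continuously.\<close>

definition expanding_set :: "('a::euclidean_space \<Rightarrow> 'a) \<Rightarrow> real \<Rightarrow> 'a set" where
  "expanding_set F r = {x. \<forall>y. dist x y < r \<longrightarrow> r * dist x y \<le> dist (F x) (F y)}"

text \<open>On a piece of diameter below \<open>r\<close> the map is injective with inverse of
  Lipschitz constant \<open>1 / r\<close>, so that piece of the preimage is a Lipschitz image of a
  null set. Negligibility is a local property. The radius \<open>r / 2\<close> keeps any two points
  of the piece closer than \<open>r\<close>.\<close>

lemma negligible_expanding_preimage:
  fixes F :: "'a::euclidean_space \<Rightarrow> 'a"
  assumes A: "negligible A" and r: "r > 0"
  shows "negligible {x \<in> expanding_set F r. F x \<in> A}" (is "negligible ?S")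
  unfolding locally_negligible_alt[of ?S]
proof (intro ballI exI conjI)
  fix x assume x: "x \<in> ?S"
  define B where "B = ?S \<inter> ball x (r / 2)"
  show "openin (top_of_set ?S) B"
    unfolding B_def by (intro openin_open_Int open_ball)
  show "x \<in> B"
    using x r by (simp add: B_def)
  have ex: "r * dist y z \<le> dist (F y) (F z)" if "y \<in> B" "z \<in> B" for y z
  proof -
    have "dist y z < r"
      using that dist_triangle_half_r[of x y r z] by (simp add: B_def dist_commute)
    then show ?thesis
      using that by (simp add: B_def expanding_set_def)
  qed
  have inj: "inj_on F B"
  proof (rule inj_onI)
    fix y z assume "y \<in> B" "z \<in> B" "F y = F z"
    then have "r * dist y z \<le> 0" using ex[of y z] by simp
    then show "y = z" using r by (simp add: mult_le_0_iff)
  qed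
  have "negligible (inv_into B F ` F ` B)"
  proof (rule negligible_locally_Lipschitz_image)
    show "negligible (F ` B)"
      by (rule negligible_subset[OF A]) (auto simp: B_def)
    fix u assume u: "u \<in> F ` B"
    show "\<exists>T Ba. open T \<and> u \<in> T \<and> (\<forall>y\<in>F ` B \<inter> T. norm (inv_into B F y - inv_into B F u) \<le> Ba * norm (y - u))"
    proof (intro exI[of _ UNIV] exI[of _ "1 / r"] conjI ballI)
      fix v assume v: "v \<in> F ` B \<inter> UNIV"
      show "norm (inv_into B F v - inv_into B F u) \<le> 1 / r * norm (v - u)"
        using ex[of "inv_into B F v" "inv_into B F u"] u v r
        by (auto simp: inv_into_into f_inv_into_f dist_norm field_simps)
    qed auto
  qed simp
  then show "negligible B"
    using inj by simp
qed

lemma derivative_inj_expanding: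
  fixes F :: "'a::euclidean_space \<Rightarrow> 'a"
  assumes "(F has_derivative F') (at x)" "inj F'"
  obtains r where "r > 0" "x \<in> expanding_set F r"
proof -
  have lin: "linear F'"
    using assms(1) has_derivative_linear by blast
  obtain B where B: "B > 0" "\<And>h. B * norm h \<le> norm (F' h)"
    using linear_inj_bounded_below_pos[OF lin assms(2)] by blast
  obtain d where d: "d > 0" "\<And>y. norm (y - x) < d \<Longrightarrow> norm (F y - F x - F' (y - x)) \<le> (B / 2) * norm (y - x)"
    using assms(1) B(1) unfolding has_derivative_at_alt by (meson half_gt_zero)
  show thesis
  proof (rule that)
    \<comment> \<open>Half of the lower bound \<open>B\<close> of the derivative is given up to the
      remainder term, which is controlled within distance \<open>d\<close>.\<close>
    show "min (B / 2) d > 0" using B d by simp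
    have "min (B / 2) d * dist x y \<le> dist (F x) (F y)" if "dist x y < min (B / 2) d" for y
    proof -
      have "norm (F y - F x - F' (y - x)) \<le> (B / 2) * norm (y - x)"
        using d(2)[of y] that by (simp add: dist_norm norm_minus_commute[of x y])
      moreover have "norm (F' (y - x)) \<le> norm (F y - F x) + norm (F y - F x - F' (y - x))"
        using norm_triangle_ineq2[of "F' (y - x)" "F y - F x"] by (simp add: norm_minus_commute)
      ultimately have "B / 2 * norm (y - x) \<le> norm (F y - F x)"
        using B(2)[of "y - x"] by (simp add: algebra_simps)
      moreover have "min (B / 2) d * norm (y - x) \<le> B / 2 * norm (y - x)"
        by (intro mult_right_mono) auto
      ultimately show ?thesis by (simp add: dist_norm norm_minus_commute)
    qed
    then show "x \<in> expanding_set F (min (B / 2) d)"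
      by (simp add: expanding_set_def)
  qed
qed

lemma expanding_set_antimono:
  assumes "r \<le> s" shows "expanding_set F s \<subseteq> expanding_set F r"
proof
  fix x assume x: "x \<in> expanding_set F s"
  have "r * dist x y \<le> dist (F x) (F y)" if "dist x y < r" for y
  proof -
    have "r * dist x y \<le> s * dist x y"
      using assms by (intro mult_right_mono) auto
    also have "\<dots> \<le> dist (F x) (F y)"
      using x that assms by (simp add: expanding_set_def)
    finally show ?thesis .
  qed
  then show "x \<in> expanding_set F r"
    by (simp add: expanding_set_def)
qed

text \<open>For every \<open>s\<close> and \<open>k\<close> the hits of \<open>A\<close> inside the
  expanding set are null in \<open>x\<close>; Fubini makes them null in \<open>s\<close> for almost
  every \<open>x\<close>. At a point of differentiability all but finitely many \<open>s\<close>
  fall into some \<open>Z k\<close>, so these hits are all that matter. Working with the closed sets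
  \<open>Z k\<close> avoids any measurability question about the derivative.\<close>

theorem AE_displacement_avoids_null_set:
  fixes g :: "real^'n \<Rightarrow> real^'n"
  assumes lip: "\<And>x y. norm (g x - g y) \<le> L * norm (x - y)"
    and A: "A \<in> sets borel" "negligible A"
  shows "AE x in lborel. AE s in lborel. x + s *\<^sub>R g x \<notin> A"
proof -
  have cont: "continuous_on UNIV g"
    by (rule continuous_on_Lipschitz[OF lip])
  define F where "F s x = x + s *\<^sub>R g x" for s x
  define Z where "Z k = {z. fst z \<in> expanding_set (F (snd z)) (1 / Suc k)}" for k
  have Z: "closed (Z k)" for k
  proof -
    \<comment> \<open>The strict inequality in the premise of the implication makes its negation
      closed, so each \<open>y\<close> contributes a union of two closed sets.\<close>
    have "Z k = (\<Inter>y. {z. 1 / Suc k \<le> dist (fst z) y} \<union>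
        {z. 1 / Suc k * dist (fst z) y \<le> dist (F (snd z) (fst z)) (F (snd z) y)})"
      by (simp add: Z_def expanding_set_def set_eq_iff imp_conv_disj not_less)
    also have "closed \<dots>"
      unfolding F_def
      by (intro closed_INT ballI closed_Un closed_Collect_le continuous_intros continuous_on_compose2[OF cont]) auto
    finally show ?thesis .
  qed
  have FA: "{z. F (snd z) (fst z) \<in> A} \<in> sets borel"
  proof -
    have "(\<lambda>z. F (snd z) (fst z)) \<in> borel_measurable borel"
      unfolding F_def
      by (intro borel_measurable_continuous_onI continuous_intros continuous_on_compose2[OF cont]) auto
    from measurable_sets_borel[OF this A(1)] show ?thesis
      by (simp add: vimage_def)
  qed
  have "AE x in lborel. AE s in lborel. \<not> (F s x \<in> A \<and> (x, s) \<in> Z k)" for k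
  proof (subst AE_lborel_commute)
    have "{z. \<not> (F (snd z) (fst z) \<in> A \<and> (fst z, snd z) \<in> Z k)} = - ({z. F (snd z) (fst z) \<in> A} \<inter> Z k)"
      by auto
    then show "{z. \<not> (F (snd z) (fst z) \<in> A \<and> (fst z, snd z) \<in> Z k)} \<in> sets borel"
      using FA Z[of k] by (simp add: borel_comp borel_closed)
    have "negligible {x \<in> expanding_set (F s) (1 / Suc k). F s x \<in> A}" for s
      by (rule negligible_expanding_preimage[OF A(2)]) simp
    then show "AE s in lborel. AE x in lborel. \<not> (F s x \<in> A \<and> (x, s) \<in> Z k)"
      unfolding AE_lborel_iff_negligible by (auto simp: Z_def conj_commute intro!: AE_I2)
  qed
  then have "AE x in lborel. \<forall>k. AE s in lborel. \<not> (F s x \<in> A \<and> (x, s) \<in> Z k)"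
    by (simp add: AE_all_countable)
  moreover have "AE x in lborel. g differentiable (at x)"
    by (rule Rademacher[OF lip])
  ultimately show ?thesis
  proof eventually_elim
    case (elim x)
    obtain D where D: "(g has_derivative D) (at x)"
      using elim(2) by (auto simp: differentiable_def)
    have "finite {s. \<not> inj (\<lambda>h. h + s *\<^sub>R D h)}"
      by (rule finite_singular_perturbations[OF has_derivative_linear[OF D]])
    then have "AE s in lborel. inj (\<lambda>h. h + s *\<^sub>R D h)"
      unfolding AE_lborel_iff_negligible by (rule negligible_finite)
    moreover have "AE s in lborel. \<forall>k. \<not> (F s x \<in> A \<and> (x, s) \<in> Z k)"
      using elim(1) by (rule AE_all_countable[THEN iffD2])
    ultimately show ?case
    proof eventually_elim
      case (elim s)
      have "(F s has_derivative (\<lambda>h. h + s *\<^sub>R D h)) (at x)"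
        unfolding F_def using D by (auto intro!: derivative_eq_intros)
      then obtain r where r: "r > 0" "x \<in> expanding_set (F s) r"
        using derivative_inj_expanding elim(1) by blast
      obtain k where "1 / Suc k < r"
        using nat_approx_posE[OF r(1)] by auto
      then have "(x, s) \<in> Z k"
        using r expanding_set_antimono[of "1 / Suc k" r "F s"] by (auto simp: Z_def)
      then show ?case
        using elim(2) unfolding F_def by blast
    qed
  qed
qed

section \<open>Hausdorff null sets and cylinders\<close>

text \<open>For null sets the normalising constant is only a factor, and the content at the single
  scale 1 already vanishes. As \<open>m\<close> is positive, empty sets contribute
  \<open>0 ^ m = 0\<close>, in agreement with their special treatment in the content.\<close>

lemma hausdorff_null_imp_cover:
  assumes "m \<ge> 1" and H: "hausdorff_outer_measure m E = 0" and e: "e > 0"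
  obtains U :: "nat \<Rightarrow> 'a::metric_space set" where "E \<subseteq> (\<Union>i. U i)" "\<And>i. bounded (U i)"
    "(\<Sum>i. ennreal (diameter (U i) ^ m)) \<le> ennreal e"
proof -
  define c where "c = unit_ball_vol (real m) / 2 ^ m"
  have c: "c > 0" by (simp add: c_def)
  have "hausdorff_content m 1 E \<le> hausdorff_outer_measure m E"
    unfolding hausdorff_outer_measure_def by (rule SUP_upper) simp
  then have "hausdorff_content m 1 E < ennreal (c * e)"
    using H c e by (simp add: ennreal_zero_less_mult_iff)
  then obtain U :: "nat \<Rightarrow> 'a set" where U: "E \<subseteq> (\<Union>i. U i)" "\<And>i. bounded (U i)"
    and s: "(\<Sum>i. if U i = {} then 0 else ennreal (unit_ball_vol (real m) * (diameter (U i) / 2) ^ m)) < ennreal (c * e)"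
    unfolding hausdorff_content_def INF_less_iff by blast
  have "ennreal (diameter (U i) ^ m) = ennreal (1 / c) *
      (if U i = {} then 0 else ennreal (unit_ball_vol (real m) * (diameter (U i) / 2) ^ m))" for i
  proof (cases "U i = {}")
    case True
    then show ?thesis using assms(1) by simp
  next
    case False
    have "diameter (U i) ^ m = 1 / c * (unit_ball_vol (real m) * (diameter (U i) / 2) ^ m)"
      using unit_ball_vol_pos[of "real m"] by (simp add: c_def power_divide less_imp_neq[symmetric])
    moreover have "0 \<le> diameter (U i)"
      using U(2) diameter_ge_0 by blast
    ultimately show ?thesis
      using False c by (simp add: ennreal_mult'[symmetric])
  qed
  then have "(\<Sum>i. ennreal (diameter (U i) ^ m)) = ennreal (1 / c) *
      (\<Sum>i. if U i = {} then 0 else ennreal (unit_ball_vol (real m) * (diameter (U i) / 2) ^ m))"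
    by simp
  also have "\<dots> \<le> ennreal (1 / c) * ennreal (c * e)"
    using s by (intro mult_left_mono) auto
  also have "\<dots> = ennreal e"
    using c e by (simp add: ennreal_mult'[symmetric])
  finally show thesis
    using U that by blast
qed

text \<open>The scale restriction is automatic: if the sum of all \<open>diameter (U i) ^ m\<close>
  is at most \<open>\<delta> ^ m\<close>, then so is each term, and every diameter is at most
  \<open>\<delta>\<close>.\<close>

lemma hausdorff_null_if_covers:
  fixes E :: "'a::metric_space set"
  assumes "m \<ge> 1"
    and cover: "\<And>e. e > 0 \<Longrightarrow> \<exists>U :: nat \<Rightarrow> 'a set. E \<subseteq> (\<Union>i. U i) \<and> (\<forall>i. bounded (U i)) \<and>
      (\<Sum>i. ennreal (diameter (U i) ^ m)) \<le> ennreal e"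
  shows "hausdorff_outer_measure m E = 0"
proof -
  define c where "c = unit_ball_vol (real m) / 2 ^ m"
  have c: "c > 0" by (simp add: c_def)
  have "hausdorff_content m \<delta> E \<le> 0" if \<delta>: "\<delta> > 0" for \<delta>
  proof (rule ennreal_le_epsilon)
    fix e :: real assume e: "e > 0"
    define \<epsilon> where "\<epsilon> = min (e / c) (\<delta> ^ m)"
    have \<epsilon>: "\<epsilon> > 0" using e c \<delta> by (simp add: \<epsilon>_def)
    obtain U :: "nat \<Rightarrow> 'a set" where U: "E \<subseteq> (\<Union>i. U i)" "\<And>i. bounded (U i)"
      and s: "(\<Sum>i. ennreal (diameter (U i) ^ m)) \<le> ennreal \<epsilon>"
      using cover[OF \<epsilon>] by blast
    have d0: "0 \<le> diameter (U i)" for i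
      using U(2) diameter_ge_0 by blast
    have "diameter (U i) \<le> \<delta>" for i
    proof -
      have "ennreal (diameter (U i) ^ m) = (\<Sum>i\<in>{i}. ennreal (diameter (U i) ^ m))"
        by simp
      also have "\<dots> \<le> (\<Sum>i. ennreal (diameter (U i) ^ m))"
        by (intro sum_le_suminf summableI) auto
      also have "\<dots> \<le> ennreal (\<delta> ^ m)"
        by (rule order_trans[OF s ennreal_leI]) (simp add: \<epsilon>_def)
      finally have "diameter (U i) ^ m \<le> \<delta> ^ m"
        using \<delta> by simp
      then show ?thesis
        using assms(1) \<delta> d0 by (simp add: power_mono_iff)
    qed
    then have "hausdorff_content m \<delta> E \<le>
        (\<Sum>i. if U i = {} then 0 else ennreal (unit_ball_vol (real m) * (diameter (U i) / 2) ^ m))"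
      unfolding hausdorff_content_def using U by (intro INF_lower) auto
    also have "\<dots> \<le> (\<Sum>i. ennreal c * ennreal (diameter (U i) ^ m))"
    proof (intro suminf_le summableI)
      show "(if U i = {} then 0 else ennreal (unit_ball_vol (real m) * (diameter (U i) / 2) ^ m))
          \<le> ennreal c * ennreal (diameter (U i) ^ m)" for i
        using c by (simp add: ennreal_mult'[symmetric] c_def power_divide)
    qed
    also have "\<dots> \<le> ennreal c * ennreal \<epsilon>"
      using s by (simp add: mult_left_mono)
    also have "\<dots> \<le> ennreal c * ennreal (e / c)"
      by (intro mult_left_mono) (auto simp: \<epsilon>_def intro: ennreal_leI)
    also have "\<dots> = ennreal e"
      using c e by (simp add: ennreal_mult'[symmetric])
    finally show "hausdorff_content m \<delta> E \<le> 0 + ennreal e" by simp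
  qed
  then show ?thesis
    unfolding hausdorff_outer_measure_def by (auto intro!: SUP_eqI)
qed

lemma hausdorff_null_if_countable_covers:
  fixes E :: "'a::metric_space set"
  assumes "m \<ge> 1"
    and cover: "\<And>e. e > 0 \<Longrightarrow> \<exists>C (U :: 'b \<Rightarrow> 'a set). countable C \<and> E \<subseteq> (\<Union>j\<in>C. U j) \<and> (\<forall>j\<in>C. bounded (U j)) \<and>
      (\<forall>I. finite I \<and> I \<subseteq> C \<longrightarrow> (\<Sum>j\<in>I. diameter (U j) ^ m) \<le> e)"
  shows "hausdorff_outer_measure m E = 0"
proof (rule hausdorff_null_if_covers[OF assms(1)])
  fix e :: real assume "e > 0"
  then obtain C and U :: "'b \<Rightarrow> 'a set" where C: "countable C" "E \<subseteq> (\<Union>j\<in>C. U j)" "\<And>j. j \<in> C \<Longrightarrow> bounded (U j)"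
    and s: "\<And>I. \<lbrakk>finite I; I \<subseteq> C\<rbrakk> \<Longrightarrow> (\<Sum>j\<in>I. diameter (U j) ^ m) \<le> e"
    using cover by metis
  define t where "t = to_nat_on C"
  have inj: "inj_on t C"
    unfolding t_def by (rule inj_on_to_nat_on[OF C(1)])
  define V where "V i = (if i \<in> t ` C then U (inv_into C t i) else {})" for i
  have V: "V (t j) = U j" if "j \<in> C" for j
    using that inj by (simp add: V_def)
  have d0: "0 \<le> diameter (U j)" if "j \<in> C" for j
    using C(3)[OF that] diameter_ge_0 by blast
  have "E \<subseteq> (\<Union>i. V i)"
    using C(2) V by blast
  moreover have "bounded (V i)" for i
    using C(3) by (auto simp: V_def inv_into_into)
  moreover have "(\<Sum>i. ennreal (diameter (V i) ^ m)) \<le> ennreal e"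
  proof (rule suminf_le_const[OF summableI])
    fix n :: nat
    define I where "I = {j \<in> C. t j < n}"
    have tI: "t ` I = {i \<in> {..<n}. i \<in> t ` C}"
      by (auto simp: I_def)
    have injI: "inj_on t I"
      using inj by (rule inj_on_subset) (auto simp: I_def)
    have "finite (t ` I)" unfolding tI by simp
    then have fin: "finite I"
      using injI finite_imageD by blast
    have "(\<Sum>i<n. ennreal (diameter (V i) ^ m)) = (\<Sum>i\<in>t ` I. ennreal (diameter (V i) ^ m))"
      unfolding tI using assms(1) by (intro sum.mono_neutral_right) (auto simp: V_def)
    also have "\<dots> = (\<Sum>j\<in>I. ennreal (diameter (U j) ^ m))"
      using injI V by (subst sum.reindex) (auto simp: I_def intro!: sum.cong)
    also have "\<dots> = ennreal (\<Sum>j\<in>I. diameter (U j) ^ m)"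
      using d0 by (intro sum_ennreal) (auto simp: I_def)
    also have "\<dots> \<le> ennreal e"
      using s[OF fin] by (intro ennreal_leI) (auto simp: I_def)
    finally show "(\<Sum>i<n. ennreal (diameter (V i) ^ m)) \<le> ennreal e" .
  qed
  ultimately show "\<exists>U :: nat \<Rightarrow> 'a set. E \<subseteq> (\<Union>i. U i) \<and> (\<forall>i. bounded (U i)) \<and>
      (\<Sum>i. ennreal (diameter (U i) ^ m)) \<le> ennreal e"
    by blast
qed

lemma hausdorff_null_nonexpansive_image:
  fixes f :: "'a::real_normed_vector \<Rightarrow> 'b::real_normed_vector"
  assumes "m \<ge> 1" and H: "hausdorff_outer_measure m E = 0"
    and f: "\<And>x y. norm (f x - f y) \<le> norm (x - y)"
  shows "hausdorff_outer_measure m (f ` E) = 0"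
proof (rule hausdorff_null_if_covers[OF assms(1)])
  fix e :: real assume "e > 0"
  then obtain U :: "nat \<Rightarrow> 'a set" where U: "E \<subseteq> (\<Union>i. U i)" "\<And>i. bounded (U i)"
    and s: "(\<Sum>i. ennreal (diameter (U i) ^ m)) \<le> ennreal e"
    using hausdorff_null_imp_cover[OF assms(1) H] by blast
  have nf: "norm (f x - f y) \<le> diameter (U i)" if "x \<in> U i" "y \<in> U i" for x y i
    using f[of x y] diameter_bounded_bound[OF U(2) that] by (simp add: dist_norm)
  have "f ` E \<subseteq> (\<Union>i. f ` U i)"
    using U(1) by blast
  moreover have "bounded (f ` U i)" for i
    unfolding bounded_two_points dist_norm using nf[of _ i] by blast
  moreover have "(\<Sum>i. ennreal (diameter (f ` U i) ^ m)) \<le> ennreal e"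
  proof (rule order_trans[OF suminf_le[OF _ summableI summableI] s])
    fix i
    have "0 \<le> diameter (U i)"
      using U(2) diameter_ge_0 by blast
    then have "diameter (f ` U i) \<le> diameter (U i)"
      using nf by (intro diameter_le) auto
    moreover have "0 \<le> diameter (f ` U i)"
      using \<open>bounded (f ` U i)\<close> diameter_ge_0 by blast
    ultimately show "ennreal (diameter (f ` U i) ^ m) \<le> ennreal (diameter (U i) ^ m)"
      by (intro ennreal_leI power_mono)
  qed
  ultimately show "\<exists>U :: nat \<Rightarrow> 'b set. f ` E \<subseteq> (\<Union>i. U i) \<and> (\<forall>i. bounded (U i)) \<and>
      (\<Sum>i. ennreal (diameter (U i) ^ m)) \<le> ennreal e"
    by blast
qed

lemma continuous_on_coord_proj: "continuous_on S (coord_proj B)"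
  unfolding coord_proj_def by (intro continuous_intros)

definition slab :: "'a::euclidean_space set \<Rightarrow> 'a \<Rightarrow> real \<Rightarrow> real \<Rightarrow> 'a set" where
  "slab B p r R = {v. (\<forall>b\<in>B. \<bar>v \<bullet> b - p \<bullet> b\<bar> \<le> r) \<and> (\<forall>b\<in>Basis - B. \<bar>v \<bullet> b\<bar> \<le> R)}"

lemma slab_cbox:
  fixes p :: "'a::euclidean_space"
  assumes B: "B \<subseteq> Basis" and "r \<ge> 0" "R \<ge> 0"
  shows slab_lmeasurable: "slab B p r R \<in> lmeasurable"
    and compact_slab: "compact (slab B p r R)"
    and measure_slab: "measure lebesgue (slab B p r R) = (2 * r) ^ card B * (2 * R) ^ (DIM('a) - card B)"
proof -
  define l u where "l = (\<Sum>b\<in>Basis. (if b \<in> B then p \<bullet> b - r else - R) *\<^sub>R b)"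
    and "u = (\<Sum>b\<in>Basis. (if b \<in> B then p \<bullet> b + r else R) *\<^sub>R b)"
  have slab: "slab B p r R = cbox l u"
  proof -
    have "v \<in> slab B p r R \<longleftrightarrow> v \<in> cbox l u" for v
      unfolding slab_def mem_box mem_Collect_eq l_def u_def
      using B by (auto simp: abs_le_iff split: if_splits) (force simp: algebra_simps)+
    then show ?thesis by blast
  qed
  show "slab B p r R \<in> lmeasurable" "compact (slab B p r R)"
    by (simp_all add: slab)
  have "measure lebesgue (slab B p r R) = (\<Prod>b\<in>Basis. if b \<in> B then 2 * r else 2 * R)"
    unfolding slab using assms(2,3)
    by (subst measure_completion, simp, subst content_cbox) (auto simp: l_def u_def intro!: prod.cong)
  also have "\<dots> = (2 * r) ^ card B * (2 * R) ^ (DIM('a) - card B)"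
    using B by (simp add: prod.If_cases Int_absorb1 card_Diff_subset finite_subset[OF B] Diff_eq[symmetric] flip: Diff_eq)
  finally show "measure lebesgue (slab B p r R) = (2 * r) ^ card B * (2 * R) ^ (DIM('a) - card B)" .
qed

text \<open>A covering set of diameter d yields a box of half-width d in the directions of
  \<open>B\<close> and a fixed height in the others; its volume is a constant times
  \<open>d ^ card B\<close>. Cutting with \<open>cbox l u\<close> keeps the height finite.\<close>

lemma negligible_cylinder_if_hausdorff_null:
  fixes E :: "'a::euclidean_space set"
  assumes B: "B \<subseteq> Basis" "card B \<ge> 1" and H: "hausdorff_outer_measure (card B) E = 0"
  shows "negligible {v. coord_proj B v \<in> E}"
  unfolding negligible_on_intervals[of "{v. coord_proj B v \<in> E}"]
proof (intro allI)
  fix l u :: 'a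
  obtain R where R: "R > 0" "\<And>v. v \<in> cbox l u \<Longrightarrow> norm v \<le> R"
    using bounded_cbox[of l u] unfolding bounded_pos by blast
  define k where "k = 2 ^ card B * (2 * R) ^ (DIM('a) - card B)"
  have k: "k > 0" using R by (simp add: k_def)
  show "negligible ({v. coord_proj B v \<in> E} \<inter> cbox l u)"
    unfolding negligible_outer_le
  proof (intro allI impI)
    fix e :: real assume e: "e > 0"
    obtain U where U: "E \<subseteq> (\<Union>i. U i)" "\<And>i. bounded (U i)"
      and s: "(\<Sum>i. ennreal (diameter (U i) ^ card B)) \<le> ennreal (e / k)"
      using hausdorff_null_imp_cover[OF B(2) H, of "e / k"] e k by auto
    have d0: "0 \<le> diameter (U i)" for i
      using U(2) diameter_ge_0 by blast
    \<comment> \<open>For an empty \<open>U i\<close> the point is arbitrary, but its box then has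
      width 0 and measure 0.\<close>
    define p where "p i = (SOME x. x \<in> U i)" for i
    define S where "S i = slab B (p i) (diameter (U i)) R" for i
    have S: "S i \<in> lmeasurable" for i
      unfolding S_def using slab_lmeasurable B R d0 by (metis less_imp_le)
    have "(\<Sum>i. emeasure lebesgue (S i)) = (\<Sum>i. ennreal k * ennreal (diameter (U i) ^ card B))"
    proof (rule suminf_cong)
      fix i
      have "measure lebesgue (S i) = k * diameter (U i) ^ card B"
        unfolding S_def using measure_slab[OF B(1) d0, of R "p i"] R by (simp add: k_def power_mult_distrib)
      then show "emeasure lebesgue (S i) = ennreal k * ennreal (diameter (U i) ^ card B)"
        using S[of i] k d0 by (simp add: emeasure_eq_measure2 ennreal_mult')
    qed
    also have "\<dots> \<le> ennreal k * ennreal (e / k)"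
      using s by (simp add: mult_left_mono)
    also have "\<dots> = ennreal e"
      using k e by (simp add: ennreal_mult'[symmetric])
    finally have le: "emeasure lebesgue (\<Union>i. S i) \<le> ennreal e"
      using emeasure_subadditive_countably[of S lebesgue] S by (meson fmeasurableD image_subsetI order_trans)
    have mS: "(\<Union>i. S i) \<in> lmeasurable"
      by (rule fmeasurableI) (use S le in \<open>auto simp: le_less_trans[OF _ ennreal_less_top]\<close>)
    have "{v. coord_proj B v \<in> E} \<inter> cbox l u \<subseteq> (\<Union>i. S i)"
    proof clarify
      fix v assume v: "coord_proj B v \<in> E" "v \<in> cbox l u"
      then obtain i where i: "coord_proj B v \<in> U i"
        using U(1) by blast
      then have "p i \<in> U i"
        unfolding p_def by (rule someI)
      then have d: "norm (coord_proj B v - p i) \<le> diameter (U i)"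
        using diameter_bounded_bound[OF U(2) i] by (simp add: dist_norm)
      have "\<bar>v \<bullet> b - p i \<bullet> b\<bar> \<le> diameter (U i)" if "b \<in> B" for b
      proof -
        have "b \<in> Basis" using that B by blast
        then have "v \<bullet> b - p i \<bullet> b = (coord_proj B v - p i) \<bullet> b"
          using that B(1) by (simp add: inner_diff_left inner_coord_proj)
        then show ?thesis
          using Basis_le_norm[OF \<open>b \<in> Basis\<close>, of "coord_proj B v - p i"] d by simp
      qed
      moreover have "\<bar>v \<bullet> b\<bar> \<le> R" if "b \<in> Basis" for b
        using Basis_le_norm[OF that, of v] R(2)[OF v(2)] by linarith
      ultimately have "v \<in> S i"
        by (simp add: S_def slab_def)
      then show "v \<in> (\<Union>i. S i)" by blast
    qed
    moreover have "measure lebesgue (\<Union>i. S i) \<le> e"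
      using le e mS by (simp add: emeasure_eq_measure2)
    ultimately show "\<exists>T. {v. coord_proj B v \<in> E} \<inter> cbox l u \<subseteq> T \<and> T \<in> lmeasurable \<and> measure lebesgue T \<le> e"
      using mS by blast
  qed
qed

text \<open>An open neighbourhood of the cylinder contains a short cylinder over a small ball around each point
  of \<open>E\<close>; a Vitali selection of these balls has controlled \<open>m\<close>-dimensional size.\<close>

lemma hausdorff_null_if_negligible_cylinder:
  fixes E :: "'a::euclidean_space set"
  assumes B: "B \<subseteq> Basis" "card B \<ge> 1" and E: "E \<subseteq> span B"
    and N: "negligible {v. coord_proj B v \<in> E}" (is "negligible ?N")
  shows "hausdorff_outer_measure (card B) E = 0"
proof (rule hausdorff_null_if_countable_covers[where 'b = "'a \<times> real", OF B(2)])
  fix e :: real assume e: "e > 0"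
  define n where "n = real DIM('a)"
  have n: "n > 0" by (simp add: n_def)
  \<comment> \<open>\<open>c * r ^ card B\<close> is the volume of the box with half-width
    \<open>r / n\<close> along \<open>B\<close> and 1 elsewhere. That box lies in the cylinder over
    the ball of radius \<open>r\<close>, because the norm is at most the sum of the \<open>n\<close>
    coordinates. The 10 in \<open>\<eta>\<close> below is the diameter of a ball of radius
    5.\<close>
  define c where "c = (2 / n) ^ card B * 2 ^ (DIM('a) - card B)"
  have c: "c > 0" using n by (simp add: c_def)
  define \<eta> where "\<eta> = c * e / 10 ^ card B"
  have \<eta>: "\<eta> > 0" using c e by (simp add: \<eta>_def)
  have N': "?N \<in> lmeasurable" "measure lebesgue ?N = 0"
    using N negligible_iff_measure by blast+
  obtain U where U: "open U" "?N \<subseteq> U" and U': "U \<in> lmeasurable" and mU: "measure lebesgue U < \<eta>"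
    using lmeasurable_outer_open[OF N'(1) \<eta>] N'(2) by auto
  define cyl where "cyl x r = {v. norm (coord_proj B v - x) \<le> r \<and> (\<forall>b\<in>Basis - B. \<bar>v \<bullet> b\<bar> \<le> 1)}" for x r
  define K where "K = {(x, r). x \<in> E \<and> 0 < r \<and> r \<le> 1 \<and> cyl x r \<subseteq> U}"
  have proj_E: "x \<bullet> b = 0" if "x \<in> E" "b \<in> Basis - B" for x b
  proof -
    have "span B \<subseteq> {x. x \<bullet> b = 0}"
    proof (rule span_minimal)
      show "B \<subseteq> {x. x \<bullet> b = 0}"
        using that B(1) by (auto simp: inner_Basis subset_iff)
      show "subspace {x. x \<bullet> b = 0}"
        by (auto simp: subspace_def inner_left_distrib)
    qed
    then show ?thesis using that E by blast
  qed
  have closed_cyl: "closed (cyl x r)" for x r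
  proof -
    have "cyl x r = {v. norm (coord_proj B v - x) \<le> r} \<inter> (\<Inter>b\<in>Basis - B. {v. \<bar>v \<bullet> b\<bar> \<le> 1})"
      by (auto simp: cyl_def)
    then show ?thesis
      by (auto intro!: closed_Int closed_INT closed_Collect_le continuous_intros continuous_on_coord_proj)
  qed
  obtain C where C: "countable C" "C \<subseteq> K" "fst ` K \<subseteq> (\<Union>(x, r)\<in>C. ball x (5 * r))"
    and sum: "\<And>I. \<lbrakk>finite I; I \<subseteq> C\<rbrakk> \<Longrightarrow> (\<Sum>(x, r)\<in>I. c * r ^ card B) \<le> measure lebesgue U"
  proof (rule Vitali_weighted_covering[of K cyl U "\<lambda>x r. c * r ^ card B"])
    show "0 < r \<and> r \<le> 1" if "(x, r) \<in> K" for x r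
      using that by (simp add: K_def)
    show "cyl x r \<in> lmeasurable \<and> cyl x r \<subseteq> U \<and> c * r ^ card B \<le> measure lebesgue (cyl x r)"
      if "(x, r) \<in> K" for x r
    proof (intro conjI)
      have r: "0 < r" "cyl x r \<subseteq> U" using that by (simp_all add: K_def)
      show "cyl x r \<subseteq> U" by fact
      show m: "cyl x r \<in> lmeasurable"
        using fmeasurableI2[OF U' r(2)] closed_cyl by (simp add: borel_closed)
      have "slab B x (r / n) 1 \<subseteq> cyl x r"
      proof
        fix v assume v: "v \<in> slab B x (r / n) 1"
        have "\<bar>(coord_proj B v - x) \<bullet> b\<bar> \<le> r / n" if b: "b \<in> Basis" for b
          using v b B(1) r n proj_E[of x b] \<open>(x, r) \<in> K\<close>
          by (cases "b \<in> B") (auto simp: slab_def inner_diff_left inner_coord_proj K_def)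
        then have "(\<Sum>b\<in>Basis. \<bar>(coord_proj B v - x) \<bullet> b\<bar>) \<le> (\<Sum>b\<in>(Basis::'a set). r / n)"
          by (intro sum_mono) auto
        then have "norm (coord_proj B v - x) \<le> r"
          using norm_le_l1[of "coord_proj B v - x"] by (simp add: n_def)
        then show "v \<in> cyl x r"
          using v by (simp add: cyl_def slab_def)
      qed
      then have "measure lebesgue (slab B x (r / n) 1) \<le> measure lebesgue (cyl x r)"
        using slab_lmeasurable[OF B(1), of "r / n" 1 x] r n m by (intro measure_mono_fmeasurable) auto
      then show "c * r ^ card B \<le> measure lebesgue (cyl x r)"
        using measure_slab[OF B(1), of "r / n" 1 x] r n by (simp add: c_def power_divide power_mult_distrib field_simps)
    qed
    show "disjnt (cyl x r) (cyl y s)" if "disjnt (cball x r) (cball y s)" for x r y s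
      using that by (force simp: disjnt_iff cyl_def dist_norm norm_minus_commute)
  qed (use U' that in simp_all)
  have "E \<subseteq> fst ` K"
  proof
    fix x assume x: "x \<in> E"
    \<comment> \<open>The degenerate box is the compact fibre of height 1 over \<open>x\<close>.
      Compactness provides one width \<open>d\<close> that works along the whole fibre, as in the
      tube lemma.\<close>
    have "slab B x 0 1 \<subseteq> U"
    proof
      fix v assume v: "v \<in> slab B x 0 1"
      have "coord_proj B v = x"
      proof (rule euclidean_eqI)
        fix b :: 'a assume b: "b \<in> Basis"
        show "coord_proj B v \<bullet> b = x \<bullet> b"
          using v b B(1) proj_E[OF x, of b] by (cases "b \<in> B") (auto simp: slab_def inner_coord_proj)
      qed
      then show "v \<in> U" using U(2) x by blast
    qed
    then obtain d where d: "d > 0" "(\<Union>v\<in>slab B x 0 1. ball v d) \<subseteq> U"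
      using compact_subset_open_imp_ball_epsilon_subset[OF compact_slab[OF B(1), of 0 1 x] U(1)] by auto
    define r where "r = min (d / 2) 1"
    have r: "0 < r" "r \<le> 1" "r < d" using d by (auto simp: r_def)
    have "cyl x r \<subseteq> U"
    proof
      fix v assume v: "v \<in> cyl x r"
      \<comment> \<open>\<open>v\<close> moved onto the fibre over \<open>x\<close>; the
        displacement \<open>coord_proj B v - x\<close> has norm at most \<open>r\<close>.\<close>
      define w where "w = v - coord_proj B v + x"
      have "w \<in> slab B x 0 1"
        using v B(1) proj_E[OF x] by (auto simp: w_def slab_def cyl_def inner_diff_left inner_left_distrib
            inner_coord_proj[OF B(1)] subsetD[OF B(1)])
      moreover have "v \<in> ball w d"
        using v r by (simp add: w_def cyl_def dist_norm norm_minus_commute)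
      ultimately show "v \<in> U" using d by blast
    qed
    then have "(x, r) \<in> K"
      using x r by (simp add: K_def)
    then show "x \<in> fst ` K" by force
  qed
  then have cov: "E \<subseteq> (\<Union>j\<in>C. ball (fst j) (5 * snd j))"
    using C(3) by (simp add: case_prod_beta)
  have "(\<Sum>j\<in>I. diameter (ball (fst j) (5 * snd j)) ^ card B) \<le> e" if I: "finite I" "I \<subseteq> C" for I
  proof -
    have "diameter (ball (fst j) (5 * snd j)) ^ card B = 10 ^ card B / c * (c * snd j ^ card B)" if "j \<in> I" for j
    proof -
      have "snd j > 0" using that I C by (auto simp: K_def)
      then show ?thesis using c by (simp add: power_mult_distrib)
    qed
    then have "(\<Sum>j\<in>I. diameter (ball (fst j) (5 * snd j)) ^ card B) = 10 ^ card B / c * (\<Sum>j\<in>I. c * snd j ^ card B)"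
      by (simp only: sum_distrib_left cong: sum.cong)
    also have "\<dots> \<le> 10 ^ card B / c * \<eta>"
      using sum[OF I] mU c by (intro mult_left_mono) (auto simp: case_prod_beta)
    also have "\<dots> = e" using c by (simp add: \<eta>_def)
    finally show ?thesis .
  qed
  then show "\<exists>C (U :: 'a \<times> real \<Rightarrow> 'a set). countable C \<and> E \<subseteq> (\<Union>j\<in>C. U j) \<and> (\<forall>j\<in>C. bounded (U j)) \<and>
      (\<forall>I. finite I \<and> I \<subseteq> C \<longrightarrow> (\<Sum>j\<in>I. diameter (U j) ^ card B) \<le> e)"
    using C(1) cov by (intro exI[of _ C] exI[of _ "\<lambda>j. ball (fst j) (5 * snd j)"]) auto
qed

section \<open>Plane fields\<close>

lemma orth_proj_in: "subspace W \<Longrightarrow> orth_proj W x \<in> W"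
  and orth_proj_orthogonal: "\<lbrakk>subspace W; w \<in> W\<rbrakk> \<Longrightarrow> (x - orth_proj W x) \<bullet> w = 0"
  using theI'[OF orth_proj_unique_exists[of W x]] by (auto simp: orth_proj_def)

lemma orth_proj_eqI:
  assumes "subspace W" "y \<in> W" "\<And>w. w \<in> W \<Longrightarrow> (x - y) \<bullet> w = 0"
  shows "orth_proj W x = y"
  using orth_proj_unique_exists[OF assms(1), of x] orth_proj_in[OF assms(1), of x]
    orth_proj_orthogonal[OF assms(1), of _ x] assms(2,3) by blast

lemma orth_proj_id: "\<lbrakk>subspace W; x \<in> W\<rbrakk> \<Longrightarrow> orth_proj W x = x"
  by (rule orth_proj_eqI) auto

lemma linear_orth_proj:
  assumes W: "subspace W"
  shows "linear (orth_proj W)"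
proof (rule linearI)
  show "orth_proj W (x + y) = orth_proj W x + orth_proj W y" for x y
  proof (rule orth_proj_eqI[OF W])
    show "orth_proj W x + orth_proj W y \<in> W"
      using W by (simp add: subspace_add orth_proj_in)
    show "(x + y - (orth_proj W x + orth_proj W y)) \<bullet> w = 0" if "w \<in> W" for w
      using orth_proj_orthogonal[OF W that, of x] orth_proj_orthogonal[OF W that, of y]
      by (simp add: inner_diff_left inner_add_left)
  qed
  show "orth_proj W (c *\<^sub>R x) = c *\<^sub>R orth_proj W x" for c x
  proof (rule orth_proj_eqI[OF W])
    show "c *\<^sub>R orth_proj W x \<in> W"
      using W by (simp add: subspace_scale orth_proj_in)
    show "(c *\<^sub>R x - c *\<^sub>R orth_proj W x) \<bullet> w = 0" if "w \<in> W" for w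
      using orth_proj_orthogonal[OF W that, of x] by (simp add: scaleR_diff_right[symmetric] del: scaleR_diff_right)
  qed
qed

lemma norm_orth_proj_Pythagoras:
  assumes W: "subspace W"
  shows "(norm x)\<^sup>2 = (norm (orth_proj W x))\<^sup>2 + (norm (x - orth_proj W x))\<^sup>2"
  using orth_proj_orthogonal[OF W orth_proj_in[OF W, of x], of x]
  by (simp add: power2_norm_eq_inner inner_diff_left inner_diff_right inner_commute)

lemma norm_orth_proj_le:
  assumes W: "subspace W"
  shows "norm (orth_proj W x) \<le> norm x"
  by (rule power2_le_imp_le) (use norm_orth_proj_Pythagoras[OF W, of x] in simp_all)

lemma orth_proj_span_Basis:
  assumes B: "B \<subseteq> Basis"
  shows "orth_proj (span B) v = coord_proj B v"
proof (rule orth_proj_eqI[OF subspace_span])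
  show "coord_proj B v \<in> span B"
    unfolding coord_proj_def by (intro span_sum span_scale span_base)
  have "span B \<subseteq> {w. (v - coord_proj B v) \<bullet> w = 0}"
  proof (rule span_minimal)
    show "B \<subseteq> {w. (v - coord_proj B v) \<bullet> w = 0}"
      using B by (auto simp: inner_diff_left inner_coord_proj[OF B] subsetD[OF B])
    show "subspace {w. (v - coord_proj B v) \<bullet> w = 0}"
      by (auto simp: subspace_def inner_add_right)
  qed
  then show "(v - coord_proj B v) \<bullet> w = 0" if "w \<in> span B" for w
    using that by blast
qed

text \<open>Isometries from \<open>W\<close> to \<open>V\<close> and between the orthogonal
  complements are glued together; Pythagoras shows that the result preserves norms. This carries
  arbitrary planes to coordinate planes, where boxes are available.\<close>

lemma rotation_between_subspaces:
  fixes W V :: "'a::euclidean_space set"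
  assumes W: "subspace W" and V: "subspace V" and dim: "dim W = dim V"
  obtains Q :: "'a \<Rightarrow> 'a" where "orthogonal_transformation Q" "\<And>v. orth_proj V (Q v) = Q (orth_proj W v)"
proof -
  define perp where "perp S = {y \<in> UNIV. \<forall>x\<in>S. orthogonal x y}" for S :: "'a set"
  have sub: "subspace (perp S)" for S
    by (auto simp: perp_def subspace_def orthogonal_def inner_add_right)
  have dim': "dim (perp W) = dim (perp V)"
    using dim_subspace_orthogonal_to_vectors[OF W subspace_UNIV] dim_subspace_orthogonal_to_vectors[OF V subspace_UNIV] dim
    unfolding perp_def by auto
  obtain f where f: "linear f" "f ` W = V" "\<And>x. x \<in> W \<Longrightarrow> norm (f x) = norm x"
    using isometry_subspaces[OF W V dim] by metis
  obtain g where g: "linear g" "g ` perp W = perp V" "\<And>x. x \<in> perp W \<Longrightarrow> norm (g x) = norm x"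
    using isometry_subspaces[OF sub sub dim'] by metis
  let ?P = "orth_proj W"
  define Q where "Q v = f (?P v) + g (v - ?P v)" for v
  have P: "?P v \<in> W" "v - ?P v \<in> perp W" for v
    using orth_proj_in[OF W] orth_proj_orthogonal[OF W, of _ v]
    by (auto simp: perp_def orthogonal_def inner_commute)
  have fg: "f (?P v) \<in> V" "g (v - ?P v) \<in> perp V" for v
    using P f(2) g(2) by blast+
  have lin: "linear Q"
    unfolding Q_def
    by (intro linear_compose_add linear_compose[OF linear_orth_proj[OF W] f(1), unfolded o_def]
        linear_compose[OF linear_compose_sub[OF linear_ident linear_orth_proj[OF W]] g(1), unfolded o_def])
  have projQ: "orth_proj V (Q v) = f (?P v)" for v
  proof (rule orth_proj_eqI[OF V fg(1)])
    show "(Q v - f (?P v)) \<bullet> w = 0" if "w \<in> V" for w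
      using fg(2)[of v] that by (simp add: Q_def perp_def orthogonal_def inner_commute)
  qed
  have "norm (Q v) = norm v" for v
  proof -
    have "(norm (Q v))\<^sup>2 = (norm v)\<^sup>2"
      unfolding norm_orth_proj_Pythagoras[OF V, of "Q v"] norm_orth_proj_Pythagoras[OF W, of v] projQ
      using f(3)[OF P(1), of v] g(3)[OF P(2), of v] by (simp add: Q_def)
    then show ?thesis by simp
  qed
  then have "orthogonal_transformation Q"
    using lin by (simp add: orthogonal_transformation)
  moreover have "orth_proj V (Q v) = Q (?P v)" for v
    unfolding projQ using P(1) by (simp add: Q_def orth_proj_id[OF W] linear_0[OF g(1)])
  ultimately show thesis by (rule that)
qed

lemma negligible_linear_image:
  fixes f :: "'a::euclidean_space \<Rightarrow> 'a"
  assumes "linear f" "negligible S"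
  shows "negligible (f ` S)"
  by (rule negligible_differentiable_image_negligible[OF order_refl assms(2) linear_imp_differentiable_on[OF assms(1)]])

text \<open>A rotation onto the span of \<open>dim W\<close> basis vectors maps the cylinder over
  \<open>E\<close> to a coordinate cylinder. Both kinds of null sets survive the rotation and its
  inverse.\<close>

lemma hausdorff_null_iff_negligible_cylinder:
  fixes W :: "'a::euclidean_space set"
  assumes W: "subspace W" "dim W \<ge> 1" and E: "E \<subseteq> W"
  shows "hausdorff_outer_measure (dim W) E = 0 \<longleftrightarrow> negligible {v. orth_proj W v \<in> E}"
proof -
  obtain B :: "'a set" where B: "B \<subseteq> Basis" "card B = dim W"
    using obtain_subset_with_card_n[of "dim W" "Basis :: 'a set"] dim_subset_UNIV[of W] by auto
  have "dim (span B) = card B"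
    using independent_mono[OF independent_Basis B(1)] by (simp add: dim_eq_card_independent)
  then obtain Q :: "'a \<Rightarrow> 'a" where Q: "orthogonal_transformation Q"
    and proj: "\<And>v. orth_proj (span B) (Q v) = Q (orth_proj W v)"
    using rotation_between_subspaces[OF W(1) subspace_span[of B]] B(2) by metis
  have Qlin: "linear Q" and Qnorm: "\<And>v. norm (Q v) = norm v"
    using Q by (simp_all add: orthogonal_transformation)
  have bij: "bij Q"
    using Q by (rule orthogonal_transformation_bij)
  define R where "R = inv Q"
  have RQ: "R (Q v) = v" and QR: "Q (R v) = v" for v
    using bij by (simp_all add: R_def bij_is_inj bij_is_surj surj_f_inv_f)
  have Rlin: "linear R"
    unfolding R_def using Q orthogonal_transformation_inv orthogonal_transformation_linear by blast
  have iso: "norm (Q x - Q y) \<le> norm (x - y)" "norm (R x - R y) \<le> norm (x - y)" for x y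
    using Qnorm[of "x - y"] Qnorm[of "R x - R y"] by (simp_all add: linear_diff[OF Qlin] QR)
  have RQE: "R ` Q ` S = S" for S
    by (simp add: image_image RQ)
  have cyl: "Q ` {v. orth_proj W v \<in> E} = {u. coord_proj B u \<in> Q ` E}"
  proof (intro equalityI subsetI)
    fix u assume "u \<in> Q ` {v. orth_proj W v \<in> E}"
    then show "u \<in> {u. coord_proj B u \<in> Q ` E}"
      using proj by (auto simp: orth_proj_span_Basis[OF B(1)])
  next
    fix u assume "u \<in> {u. coord_proj B u \<in> Q ` E}"
    then have "Q (orth_proj W (R u)) \<in> Q ` E"
      using proj[of "R u"] by (simp add: orth_proj_span_Basis[OF B(1)] QR)
    then have "orth_proj W (R u) \<in> E"
      using bij by (simp add: bij_is_inj inj_image_mem_iff)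
    then show "u \<in> Q ` {v. orth_proj W v \<in> E}"
      by (intro image_eqI[of _ _ "R u"]) (auto simp: QR)
  qed
  have B1: "card B \<ge> 1" using B W by simp
  have QE: "Q ` E \<subseteq> span B"
  proof
    fix u assume "u \<in> Q ` E"
    then obtain x where x: "x \<in> E" "u = Q x" by blast
    then have "u = orth_proj (span B) (Q x)"
      using E orth_proj_id[OF W(1), of x] by (auto simp: proj)
    then show "u \<in> span B"
      using orth_proj_in[OF subspace_span] by simp
  qed
  have "hausdorff_outer_measure (card B) E = 0 \<longleftrightarrow> hausdorff_outer_measure (card B) (Q ` E) = 0"
    using hausdorff_null_nonexpansive_image[OF B1, of E Q] iso(1)
      hausdorff_null_nonexpansive_image[OF B1, of "Q ` E" R] iso(2) RQE[of E] by auto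
  also have "\<dots> \<longleftrightarrow> negligible {u. coord_proj B u \<in> Q ` E}"
    using negligible_cylinder_if_hausdorff_null[OF B(1) B1] hausdorff_null_if_negligible_cylinder[OF B(1) B1 QE] by blast
  also have "\<dots> \<longleftrightarrow> negligible {v. orth_proj W v \<in> E}"
    unfolding cyl[symmetric]
    using negligible_linear_image[OF Qlin] negligible_linear_image[OF Rlin] RQE by metis
  finally show ?thesis
    by (simp add: B(2))
qed

text \<open>Translation to the origin followed by the cylinder criterion. From here on Hausdorff
  measure disappears, and (B) and (C) become statements about the map
  \<open>x + orth_proj W v\<close> on pairs.\<close>

lemma hausdorff_null_section_iff:
  fixes W :: "'a::euclidean_space set"
  assumes W: "W \<in> grassmannian m" and m: "m \<ge> 1"
  shows "hausdorff_outer_measure m (A \<inter> (\<lambda>w. x + w) ` W) = 0 \<longleftrightarrow> (AE v in lborel. x + orth_proj W v \<notin> A)"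
proof -
  have W': "subspace W" "dim W = m" using W by (auto simp: grassmannian_def)
  define E where "E = {w \<in> W. x + w \<in> A}"
  have 1: "A \<inter> (\<lambda>w. x + w) ` W = (\<lambda>w. x + w) ` E"
    by (auto simp: E_def)
  have 2: "(\<lambda>w. w - x) ` (\<lambda>w. x + w) ` E = E"
    by (simp add: image_image)
  have "hausdorff_outer_measure m (A \<inter> (\<lambda>w. x + w) ` W) = 0 \<longleftrightarrow> hausdorff_outer_measure m E = 0"
    unfolding 1 using hausdorff_null_nonexpansive_image[OF m, of E "\<lambda>w. x + w"]
      hausdorff_null_nonexpansive_image[OF m, of "(\<lambda>w. x + w) ` E" "\<lambda>w. w - x"] 2 by auto
  also have "\<dots> \<longleftrightarrow> negligible {v. orth_proj W v \<in> E}"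
    using hausdorff_null_iff_negligible_cylinder[OF W'(1), of E] W' m by (simp add: E_def)
  finally show ?thesis
    by (simp add: AE_lborel_iff_negligible E_def orth_proj_in[OF W'(1)])
qed

lemma lipschitz_plane_fieldD:
  assumes "lipschitz_plane_field m W"
  obtains L where "L \<ge> 0"
    "\<And>x y v. norm (orth_proj (W x) v - orth_proj (W y) v) \<le> L * norm v * norm (x - y)"
proof -
  obtain L where L: "L \<ge> 0" "\<And>x y. grassmann_dist (W x) (W y) \<le> L * dist x y"
    and W: "\<And>x. subspace (W x)"
    using assms by (auto simp: lipschitz_plane_field_def grassmannian_def)
  have "norm (orth_proj (W x) v - orth_proj (W y) v) \<le> L * norm v * norm (x - y)" for x y v
  proof -
    have "bounded_linear (\<lambda>v. orth_proj (W x) v - orth_proj (W y) v)"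
      using W by (intro bounded_linear_sub linear_conv_bounded_linear[THEN iffD1] linear_orth_proj)
    from onorm[OF this, of v]
    have "norm (orth_proj (W x) v - orth_proj (W y) v) \<le> grassmann_dist (W x) (W y) * norm v"
      by (simp add: grassmann_dist_def)
    also have "\<dots> \<le> (L * dist x y) * norm v"
      by (intro mult_right_mono L) auto
    finally show ?thesis by (simp add: dist_norm mult.commute mult.left_commute)
  qed
  with L(1) show thesis by (rule that)
qed

lemma continuous_on_orth_proj_field:
  fixes W :: "'a::euclidean_space \<Rightarrow> 'a set"
  assumes W: "\<And>x. subspace (W x)"
    and lip: "\<And>x y v. norm (orth_proj (W x) v - orth_proj (W y) v) \<le> L * norm v * norm (x - y)"
  shows "continuous_on UNIV (\<lambda>z. orth_proj (W (fst z)) (snd z))"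
  unfolding continuous_on_def
proof
  fix z :: "'a \<times> 'a"
  have "((\<lambda>z'. orth_proj (W (fst z')) (snd z') - orth_proj (W (fst z)) (snd z)) \<longlongrightarrow> 0) (at z)"
  proof (rule Lim_null_comparison)
    show "\<forall>\<^sub>F z' in at z. norm (orth_proj (W (fst z')) (snd z') - orth_proj (W (fst z)) (snd z))
        \<le> norm (snd z' - snd z) + L * norm (snd z) * norm (fst z' - fst z)"
    proof (intro always_eventually allI)
      fix z' :: "'a \<times> 'a"
      have "orth_proj (W (fst z')) (snd z') - orth_proj (W (fst z)) (snd z) =
          orth_proj (W (fst z')) (snd z' - snd z) + (orth_proj (W (fst z')) (snd z) - orth_proj (W (fst z)) (snd z))"
        by (simp add: linear_diff[OF linear_orth_proj[OF W]])
      then show "norm (orth_proj (W (fst z')) (snd z') - orth_proj (W (fst z)) (snd z))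
        \<le> norm (snd z' - snd z) + L * norm (snd z) * norm (fst z' - fst z)"
        using norm_orth_proj_le[OF W, of "fst z'" "snd z' - snd z"] lip[of "fst z'" "snd z" "fst z"]
        by (metis (no_types, lifting) add_mono norm_triangle_le)
    qed
    have "((\<lambda>z'. norm (snd z' - snd z) + L * norm (snd z) * norm (fst z' - fst z)) \<longlongrightarrow>
        norm (snd z - snd z) + L * norm (snd z) * norm (fst z - fst z)) (at z)"
      by (intro tendsto_intros)
    then show "((\<lambda>z'. norm (snd z' - snd z) + L * norm (snd z) * norm (fst z' - fst z)) \<longlongrightarrow> 0) (at z)"
      by simp
  qed
  then show "((\<lambda>z. orth_proj (W (fst z)) (snd z)) \<longlongrightarrow> orth_proj (W (fst z)) (snd z)) (at z within UNIV)"
    by (simp add: LIM_zero_iff)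
qed

section \<open>The two implications\<close>

text \<open>\<open>T\<close> and \<open>F\<close>
  T\<open>both lie in an open\<close>U\<open>barely larger than\<close>T\<open>, while\<close>F
  \<open>T\<close> keeps a definite share of the measure, so they overlap substantially. The overlap
  is the \<open>F\<close>-image of the returning points, and \<open>F\<close> preserves null sets.
  The bound \<open>\<delta>\<close> depends on \<open>T\<close> alone, so the displacement may be
  chosen after it.\<close>

lemma small_displacement_returns:
  fixes T :: "'a::euclidean_space set"
  assumes T: "compact T" "\<not> negligible T"
  obtains \<delta> where "\<delta> > 0"
    "\<And>F :: 'a \<Rightarrow> 'a. \<lbrakk>\<And>x. dist x (F x) < \<delta>; \<And>x y. norm ((F x - x) - (F y - y)) \<le> norm (x - y) / 2\<rbrakk>
       \<Longrightarrow> \<not> negligible {x \<in> T. F x \<in> T}"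
proof -
  have Tm: "T \<in> lmeasurable"
    using T(1) by (rule lmeasurable_compact)
  then have Tpos: "measure lebesgue T > 0"
    using T(2) negligible_iff_measure measure_nonneg[of lebesgue T] by (metis less_eq_real_def)
  define \<eta> where "\<eta> = measure lebesgue T / 10 ^ DIM('a)"
  have \<eta>: "\<eta> > 0" using Tpos by (simp add: \<eta>_def)
  obtain U where U: "open U" "T \<subseteq> U" and U': "U \<in> lmeasurable"
    and mU: "measure lebesgue U < measure lebesgue T + \<eta>"
    using lmeasurable_outer_open[OF Tm \<eta>] by blast
  obtain \<delta> where \<delta>: "\<delta> > 0" "(\<Union>x\<in>T. ball x \<delta>) \<subseteq> U"
    using compact_subset_open_imp_ball_epsilon_subset[OF T(1) U(1,2)] by blast
  show thesis
  proof (rule that[OF \<delta>(1)])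
    fix F :: "'a \<Rightarrow> 'a"
    assume close: "\<And>x. dist x (F x) < \<delta>"
      and lip: "\<And>x y. norm ((F x - x) - (F y - y)) \<le> norm (x - y) / 2"
    have up: "norm (F x - F y) \<le> 2 * norm (x - y)" for x y
      using norm_triangle_ineq[of "x - y" "(F x - x) - (F y - y)"] lip[of x y] norm_ge_zero[of "x - y"]
      by (simp add: algebra_simps del: norm_ge_zero)
    have low: "norm (x - y) \<le> 2 * norm (F x - F y)" for x y
      using norm_triangle_ineq2[of "x - y" "- ((F x - x) - (F y - y))"] lip[of x y]
      by (simp add: algebra_simps norm_minus_commute)
    have inj: "inj_on F T"
    proof (rule inj_onI)
      show "x = y" if "F x = F y" for x y
        using low[of x y] that by simp
    qed
    have "compact (F ` T)"
      using continuous_on_Lipschitz[of F, OF up] T(1) continuous_on_subset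
      by (intro compact_continuous_image) blast+
    then have FT: "F ` T \<in> lmeasurable"
      by (rule lmeasurable_compact)
    have GFT: "inv_into T F ` F ` T = T"
      using inj by simp
    have "measure lebesgue (inv_into T F ` F ` T) \<le> (5 * 2) ^ DIM('a) * measure lebesgue (F ` T)"
    proof (rule measure_Lipschitz_image_le[OF FT])
      show "dist (inv_into T F u) (inv_into T F v) \<le> 2 * dist u v" if "u \<in> F ` T" "v \<in> F ` T" for u v
        using low[of "inv_into T F u" "inv_into T F v"] that by (simp add: dist_norm f_inv_into_f)
    qed (use Tm GFT in auto)
    then have \<eta>_le: "\<eta> \<le> measure lebesgue (F ` T)"
      unfolding GFT by (simp add: \<eta>_def field_simps)
    show "\<not> negligible {x \<in> T. F x \<in> T}"
    proof
      assume "negligible {x \<in> T. F x \<in> T}"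
      then have "negligible (F ` {x \<in> T. F x \<in> T})"
        by (rule negligible_locally_Lipschitz_image[OF order_refl])
           (use up in \<open>auto intro!: exI[of _ UNIV] exI[of _ 2]\<close>)
      moreover have "F ` {x \<in> T. F x \<in> T} = T \<inter> F ` T"
        by auto
      ultimately have "measure lebesgue (T \<union> F ` T) = measure lebesgue T + measure lebesgue (F ` T)"
        using measure_Un3[OF Tm FT] negligible_imp_measure0 by (simp add: Int_commute)
      moreover have "measure lebesgue (T \<union> F ` T) \<le> measure lebesgue U"
      proof (rule measure_mono_fmeasurable[OF _ _ U'])
        have "F ` T \<subseteq> U"
          using \<delta>(2) close by force
        then show "T \<union> F ` T \<subseteq> U"
          using U(2) by blast
      qed (use Tm FT in auto)
      ultimately show False
        using mU \<eta>_le by linarith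
    qed
  qed
qed

text \<open>After Fubini almost every \<open>v\<close> moves almost no point of \<open>A\<close>
  into \<open>A\<close>. Such \<open>v\<close> exist in every ball around 0, which contradicts the
  positive measure of returns to a compact part \<open>T\<close> of \<open>A\<close>.\<close>

theorem plane_field_null_in_set_imp_null:
  fixes W :: "'a::euclidean_space \<Rightarrow> 'a set"
  assumes W: "\<And>x. subspace (W x)" and L: "L \<ge> 0"
    and lip: "\<And>x y v. norm (orth_proj (W x) v - orth_proj (W y) v) \<le> L * norm v * norm (x - y)"
    and A: "A \<in> sets borel"
    and ae: "AE x in lborel. x \<in> A \<longrightarrow> (AE v in lborel. x + orth_proj (W x) v \<notin> A)"
  shows "negligible A"
proof (rule ccontr)
  assume nA: "\<not> negligible A"
  have cont: "continuous_on UNIV (\<lambda>z. orth_proj (W (fst z)) (snd z))"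
    by (rule continuous_on_orth_proj_field[OF W lip])
  have m: "{z. fst z + orth_proj (W (fst z)) (snd z) \<in> A} \<in> sets borel"
  proof -
    have "(\<lambda>z. fst z + orth_proj (W (fst z)) (snd z)) \<in> borel_measurable borel"
      by (intro borel_measurable_continuous_onI continuous_intros cont)
    from measurable_sets_borel[OF this A] show ?thesis
      by (simp add: vimage_def)
  qed
  have m1: "{z. fst z \<in> A} \<in> sets (borel :: ('a \<times> 'a) measure)"
  proof -
    have "fst \<in> borel_measurable (borel :: ('a \<times> 'a) measure)"
      by (intro borel_measurable_continuous_onI continuous_intros)
    from measurable_sets_borel[OF this A] show ?thesis
      by (simp add: vimage_def)
  qed
  have "AE x in lborel. AE v in lborel. \<not> (x \<in> A \<and> x + orth_proj (W x) v \<in> A)"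
    using ae by eventually_elim auto
  moreover have "{z. \<not> (fst z \<in> A \<and> fst z + orth_proj (W (fst z)) (snd z) \<in> A)} =
      - ({z. fst z \<in> A} \<inter> {z. fst z + orth_proj (W (fst z)) (snd z) \<in> A})"
    by auto
  then have "{z. \<not> (fst z \<in> A \<and> fst z + orth_proj (W (fst z)) (snd z) \<in> A)} \<in> sets borel"
    using m m1 by (simp add: borel_comp)
  ultimately have ae': "AE v in lborel. AE x in lborel. \<not> (x \<in> A \<and> x + orth_proj (W x) v \<in> A)"
    by (subst (asm) AE_lborel_commute)
  obtain T where T: "compact T" "T \<subseteq> A" "\<not> negligible T"
  proof -
    obtain k :: nat where k: "\<not> negligible (A \<inter> cball 0 (real k))"
    proof (rule ccontr)
      assume "\<not> thesis"
      then have "negligible (\<Union>k::nat. A \<inter> cball 0 (real k))"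
        using that by (intro negligible_countable_Union) auto
      moreover have "A \<subseteq> (\<Union>k::nat. A \<inter> cball 0 (real k))"
        using real_arch_simple by fastforce
      ultimately show False using nA negligible_subset by blast
    qed
    define S where "S = A \<inter> cball 0 (real k)"
    have S: "S \<in> lmeasurable"
      using A by (auto simp: S_def intro!: bounded_set_imp_lmeasurable bounded_Int)
    have Spos: "measure lebesgue S > 0"
      using k S negligible_iff_measure measure_nonneg[of lebesgue S] unfolding S_def by (metis less_eq_real_def)
    obtain T where T: "closed T" "T \<subseteq> S" "S - T \<in> lmeasurable" "emeasure lebesgue (S - T) < ennreal (measure lebesgue S)"
      using sets_lebesgue_inner_closed[OF fmeasurableD[OF S] Spos] by blast
    have "bounded T"
      using T(2) bounded_subset[OF bounded_cball] by (auto simp: S_def)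
    moreover have "\<not> negligible T"
    proof
      assume "negligible T"
      then have "measure lebesgue (S - T) = measure lebesgue S"
        by (intro measure_Diff_null_set) (use S in \<open>auto simp: negligible_iff_null_sets\<close>)
      then show False
        using T(3,4) by (simp add: emeasure_eq_measure2 ennreal_less_iff)
    qed
    ultimately show thesis
      using that T(1,2) by (auto simp: S_def compact_eq_bounded_closed)
  qed
  obtain \<delta> where \<delta>: "\<delta> > 0"
    "\<And>F :: 'a \<Rightarrow> 'a. \<lbrakk>\<And>x. dist x (F x) < \<delta>; \<And>x y. norm ((F x - x) - (F y - y)) \<le> norm (x - y) / 2\<rbrakk>
       \<Longrightarrow> \<not> negligible {x \<in> T. F x \<in> T}"
    using small_displacement_returns[OF T(1,3)] by blast
  \<comment> \<open>The first bound limits the displacement, as projections do not increase norms;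
    the second makes \<open>L * norm v\<close> at most 1/2. Writing \<open>L + 1\<close> avoids
    division by zero.\<close>
  define \<rho> where "\<rho> = min \<delta> (1 / (2 * (L + 1)))"
  have "\<rho> > 0" using \<delta> L by (simp add: \<rho>_def)
  then obtain v where v: "v \<in> ball 0 \<rho>" "AE x in lborel. \<not> (x \<in> A \<and> x + orth_proj (W x) v \<in> A)"
    using AE_lborel_open_ex[OF ae' open_ball, of 0 \<rho>] by (auto simp: ball_eq_empty)
  have "\<not> negligible {x \<in> T. x + orth_proj (W x) v \<in> T}"
  proof (rule \<delta>(2))
    show "dist x (x + orth_proj (W x) v) < \<delta>" for x
      using norm_orth_proj_le[OF W, of x v] v(1) by (simp add: dist_norm \<rho>_def)
    have "L * norm v \<le> (L + 1) * (1 / (2 * (L + 1)))"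
      using v(1) L by (intro mult_mono) (auto simp: \<rho>_def)
    also have "\<dots> = 1 / 2"
      using L by (simp add: field_simps)
    finally have "L * norm v \<le> 1 / 2" .
    then have half: "L * norm v * norm (x - y) \<le> 1 / 2 * norm (x - y)" for x y
      by (intro mult_right_mono) auto
    show "norm ((x + orth_proj (W x) v - x) - (y + orth_proj (W y) v - y)) \<le> norm (x - y) / 2" for x y
      using order_trans[OF lip[of x v y] half[of x y]] by simp
  qed
  moreover have "{x \<in> T. x + orth_proj (W x) v \<in> T} \<subseteq> {x. \<not> \<not> (x \<in> A \<and> x + orth_proj (W x) v \<in> A)}"
    using T(2) by blast
  ultimately show False
    using v(2) negligible_subset unfolding AE_lborel_iff_negligible by blast
qed

text \<open>The displacement theorem applies for each fixed \<open>v\<close>. Fubini is then used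
  with \<open>(s, x)\<close> as one variable against \<open>v\<close>, and finally to split this
  pair, so that a common \<open>s\<close> serves almost all \<open>x\<close> and
  \<open>v\<close>.\<close>

theorem null_imp_plane_field_null:
  fixes W :: "real^'n \<Rightarrow> (real^'n) set"
  assumes W: "\<And>x. subspace (W x)"
    and lip: "\<And>x y v. norm (orth_proj (W x) v - orth_proj (W y) v) \<le> L * norm v * norm (x - y)"
    and A: "A \<in> sets borel" "negligible A"
  shows "AE x in lborel. AE v in lborel. x + orth_proj (W x) v \<notin> A"
proof -
  have cont: "continuous_on UNIV (\<lambda>z. orth_proj (W (fst z)) (snd z))"
    by (rule continuous_on_orth_proj_field[OF W lip])
  have sc: "orth_proj (W x) (s *\<^sub>R v) = s *\<^sub>R orth_proj (W x) v" for x s v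
    by (rule linear_scale[OF linear_orth_proj[OF W]])
  have meas: "{z. \<phi> z \<notin> A} \<in> sets borel" if "continuous_on UNIV \<phi>" for \<phi> :: "'b::topological_space \<Rightarrow> real^'n"
    using measurable_sets_borel[OF borel_measurable_continuous_onI[OF that], of "- A"] A(1)
    by (simp add: vimage_def borel_comp)
  have "AE s in lborel. AE x in lborel. x + s *\<^sub>R orth_proj (W x) v \<notin> A" for v
  proof -
    have "AE x in lborel. AE s in lborel. x + s *\<^sub>R orth_proj (W x) v \<notin> A"
      by (rule AE_displacement_avoids_null_set[OF _ A]) (rule lip)
    moreover have "{z :: (real^'n) \<times> real. fst z + snd z *\<^sub>R orth_proj (W (fst z)) v \<notin> A} \<in> sets borel"
      using continuous_on_Lipschitz[of "\<lambda>x. orth_proj (W x) v", OF lip]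
      by (intro meas continuous_intros continuous_on_compose2[of UNIV "\<lambda>x. orth_proj (W x) v" _ fst]) auto
    ultimately show ?thesis
      by (subst (asm) AE_lborel_commute)
  qed
  then have "AE z in lborel. snd z + fst z *\<^sub>R orth_proj (W (snd z)) v \<notin> A" for v
  proof -
    have "{z :: real \<times> (real^'n). snd z + fst z *\<^sub>R orth_proj (W (snd z)) v \<notin> A} \<in> sets borel"
      using continuous_on_Lipschitz[of "\<lambda>x. orth_proj (W x) v", OF lip]
      by (intro meas continuous_intros continuous_on_compose2[of UNIV "\<lambda>x. orth_proj (W x) v" _ snd]) auto
    then have "AE z in lborel \<Otimes>\<^sub>M lborel. snd z + fst z *\<^sub>R orth_proj (W (snd z)) v \<notin> A"
      using \<open>\<And>v. AE s in lborel. AE x in lborel. x + s *\<^sub>R orth_proj (W x) v \<notin> A\<close>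
      by (intro lborel_pair.AE_pair_measure) (simp_all only: lborel_prod space_lborel space_borel sets_lborel UNIV_I simp_thms fst_conv snd_conv)
    then show ?thesis by (simp only: lborel_prod)
  qed
  then have "AE v in lborel. AE z in lborel. snd z + fst z *\<^sub>R orth_proj (W (snd z)) v \<notin> A"
    by simp
  moreover have "{y :: (real^'n) \<times> (real \<times> (real^'n)).
      snd (snd y) + fst (snd y) *\<^sub>R orth_proj (W (snd (snd y))) (fst y) \<notin> A} \<in> sets borel"
  proof -
    have "continuous_on UNIV (\<lambda>y :: (real^'n) \<times> (real \<times> (real^'n)). (snd (snd y), fst y))"
      by (intro continuous_intros)
    from continuous_on_compose2[OF cont this] show ?thesis
      by (intro meas continuous_intros) auto
  qed
  ultimately have "AE z in lborel. AE v in lborel. snd z + fst z *\<^sub>R orth_proj (W (snd z)) v \<notin> A"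
    by (subst (asm) AE_lborel_commute)
  then have "AE z in lborel \<Otimes>\<^sub>M lborel. AE v in lborel. snd z + fst z *\<^sub>R orth_proj (W (snd z)) v \<notin> A"
    by (simp only: lborel_prod)
  from lborel_pair.AE_pair[OF this]
  have ae: "AE s in lborel. AE x in lborel. AE v in lborel. x + s *\<^sub>R orth_proj (W x) v \<notin> A"
    by simp
  \<comment> \<open>Positivity allows division by \<open>s\<close>: since \<open>orth_proj\<close>
    is homogeneous in \<open>v\<close>, the bad set at scale 1 is contained in the
    \<open>s\<close>-fold dilation of the null bad set at scale \<open>s\<close>.\<close>
  obtain s :: real where s: "s \<in> {0<..}" "AE x in lborel. AE v in lborel. x + s *\<^sub>R orth_proj (W x) v \<notin> A"
    using AE_lborel_open_ex[OF ae open_greaterThan[of 0]] greaterThan_non_empty[of "0::real"] by blast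
  from s(2) show ?thesis
  proof eventually_elim
    case (elim x)
    have "negligible ((\<lambda>v. s *\<^sub>R v) ` {v. x + s *\<^sub>R orth_proj (W x) v \<in> A})"
      using elim unfolding AE_lborel_iff_negligible
      by (intro negligible_linear_image) (simp_all add: linear_scaleR)
    moreover have "{v. x + orth_proj (W x) v \<in> A} \<subseteq> (\<lambda>v. s *\<^sub>R v) ` {v. x + s *\<^sub>R orth_proj (W x) v \<in> A}"
    proof
      fix v assume "v \<in> {v. x + orth_proj (W x) v \<in> A}"
      then show "v \<in> (\<lambda>v. s *\<^sub>R v) ` {v. x + s *\<^sub>R orth_proj (W x) v \<in> A}"
        using s(1) by (intro image_eqI[of _ _ "(1 / s) *\<^sub>R v"]) (auto simp: sc)
    qed
    ultimately show ?case
      unfolding AE_lborel_iff_negligible using negligible_subset by auto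
  qed
qed

theorem mainTheorem1:
  fixes m :: nat
    and W\<^sub>0 :: "real ^ 'n \<Rightarrow> (real ^ 'n) set"
    and A :: "(real ^ 'n) set"
  assumes "1 \<le> m" and "m \<le> CARD('n) - 1"
    and "lipschitz_plane_field m W\<^sub>0"
    and "A \<in> sets borel"
  shows "(outer_measure_of lborel A = 0 \<longleftrightarrow>
           (AE x in lborel. x \<in> A \<longrightarrow>
              hausdorff_outer_measure m (A \<inter> (\<lambda>w. x + w) ` W\<^sub>0 x) = 0)) \<and>
         ((AE x in lborel. x \<in> A \<longrightarrow>
              hausdorff_outer_measure m (A \<inter> (\<lambda>w. x + w) ` W\<^sub>0 x) = 0) \<longleftrightarrow>
           (AE x in lborel. hausdorff_outer_measure m (A \<inter> (\<lambda>w. x + w) ` W\<^sub>0 x) = 0))"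
proof -
  have G: "W\<^sub>0 x \<in> grassmannian m" and W: "subspace (W\<^sub>0 x)" for x
    using assms(3) by (auto simp: lipschitz_plane_field_def grassmannian_def)
  obtain L where L: "L \<ge> 0"
    "\<And>x y v. norm (orth_proj (W\<^sub>0 x) v - orth_proj (W\<^sub>0 y) v) \<le> L * norm v * norm (x - y)"
    using lipschitz_plane_fieldD[OF assms(3)] by blast
  \<comment> \<open>On the Borel set \<open>A\<close> the outer measure agrees with the
    measure.\<close>
  have null: "outer_measure_of lborel A = 0 \<longleftrightarrow> negligible A"
    using assms(4) by (simp add: negligible_iff_null_sets null_sets_completion_iff null_sets_def)
  have restrict: "AE x in lborel. x \<in> A \<longrightarrow> P x" if "AE x in lborel. P x" for P
    using that by eventually_elim simp
  show ?thesis
    \<comment> \<open>The equivalences close as a cycle: (A) gives (C), (C) restricts to (B), and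
      (B) gives (A).\<close>
    unfolding null hausdorff_null_section_iff[OF G assms(1)]
    using null_imp_plane_field_null[OF W L(2) assms(4)] plane_field_null_in_set_imp_null[OF W L assms(4)]
      restrict[of "\<lambda>x. AE v in lborel. x + orth_proj (W\<^sub>0 x) v \<notin> A"]
    by blast
qed

end
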